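(* Let $a,b$ be positive integers with $a+b=n$. With $\Phi_a=\nabla D_a\nabla^{-1}$ and $\Psi_b=-(qt)^{1-b}\nabla D_b^*\nabla^{-1}$, $$\tfrac1M[\Psi_b,\Phi_a]=\frac{qt}{qt-1}\,\nabla\,\underline{h_n\big[X(\tfrac1{qt}-1)\big]}\,\nabla^{-1}.$$
   Context: Work over $\mathbb{Q}(q,t)$; $\Lambda$ is the algebra of symmetric functions in $X=x_1+x_2+\cdots$. Plethystic notation: $p_k[E]$ is $E$ with every variable (including $q,t$) raised to the $k$-th power; $F[E]$ substitutes $p_k\mapsto p_k[E]$ in the power-sum expansion of $F$. $\Omega[E]=\exp(\sum_{k\ge1}p_k[E]/k)$. $M=(1-t)(1-q)$, $\widetilde M=(1-1/t)(1-1/q)$. For $k\in\mathbb{Z}$: $D_kF=F[X+\tfrac Mz]\Omega[-zX]|_{z^k}$, $D_k^*F=F[X-\tfrac{\widetilde M}z]\Omega[zX]|_{z^k}$ (coefficient of $z^k$). $\underline{G}$ is multiplication by $G$. $\nabla$ is the operator with $\nabla\widetilde H_\mu=t^{n(\mu)}q^{n(\mu')}\widetilde H_\mu$, where $\widetilde H_\mu[X;q,t]=t^{n(\mu)}J_\mu[\tfrac{X}{1-1/t};q,1/t]$ are the modified Macdonald polynomials ($J_\mu$ Macdonald's integral form), $n(\mu)=\sum_i(i-1)\mu_i$, $\mu'$ the conjugate. $[A,B]=AB-BA$. *)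

theory Defs
  imports
    "HOL-Computational_Algebra.Computational_Algebra"
    "HOL-Library.Poly_Mapping"
begin

text \<open>The coefficients of the outer polynomials are polynomials in \<open>q\<close>; the outer variable
  is \<open>t\<close>.\<close>

type_synonym ratfun = "rat poly poly fract"

definition qq :: ratfun where "qq = Fract [:[:0, 1:]:] 1"

definition tt :: ratfun where "tt = Fract [:0, 1:] 1"

definition bipoly_eval :: "ratfun \<Rightarrow> ratfun \<Rightarrow> rat poly poly \<Rightarrow> ratfun" where
  "bipoly_eval a b f = poly (map_poly (\<lambda>c. poly (map_poly of_rat c) a) f) b"

text \<open>The substitution \<open>q \<mapsto> a\<close>, \<open>t \<mapsto> b\<close> in a rational function. The value is independent of
  the representation as a fraction when \<open>a\<close> and \<open>b\<close> are algebraically independent, which is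
  the case for the substitutions used here.\<close>

definition ratfun_subst :: "ratfun \<Rightarrow> ratfun \<Rightarrow> ratfun \<Rightarrow> ratfun" where
  "ratfun_subst a b x =
     (THE y. \<exists>f g. g \<noteq> 0 \<and> x = Fract f g \<and> y = bipoly_eval a b f / bipoly_eval a b g)"

definition MM :: ratfun where "MM = (1 - tt) * (1 - qq)"

definition MM_tilde :: ratfun where "MM_tilde = (1 - 1 / tt) * (1 - 1 / qq)"

text \<open>\<open>\<Lambda>\<close> is the polynomial ring in the power sums: the generator with index \<open>i\<close> is
  \<open>p\<^sub>i\<^sub>+\<^sub>1\<close>, and a monomial \<open>m\<close> is the power sum product in which \<open>p\<^sub>i\<^sub>+\<^sub>1\<close> occurs
  \<open>lookup m i\<close> times.\<close>

type_synonym sym = "(nat \<Rightarrow>\<^sub>0 nat) \<Rightarrow>\<^sub>0 ratfun"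

definition sconst :: "ratfun \<Rightarrow> sym" where
  "sconst c = Poly_Mapping.single 0 c"

definition psum :: "nat \<Rightarrow> sym" where
  "psum k = Poly_Mapping.single (Poly_Mapping.single (k - 1) 1) 1"

definition sym_scale :: "ratfun \<Rightarrow> sym \<Rightarrow> sym" where
  "sym_scale c F = sconst c * F"

text \<open>Replace every \<open>p\<^sub>k\<close> by \<open>a k\<close> and every coefficient \<open>c\<close> by \<open>\<phi> c\<close> in the power sum
  expansion.\<close>

definition sym_eval :: "(ratfun \<Rightarrow> 'r::comm_ring_1) \<Rightarrow> (nat \<Rightarrow> 'r) \<Rightarrow> sym \<Rightarrow> 'r" where
  "sym_eval \<phi> a F =
     (\<Sum>m\<in>Poly_Mapping.keys F. \<phi> (Poly_Mapping.lookup F m) *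
        (\<Prod>i\<in>Poly_Mapping.keys m. a (Suc i) ^ Poly_Mapping.lookup m i))"

text \<open>The operations \<open>E \<mapsto> p\<^sub>k[E]\<close> (for \<open>k \<ge> 1\<close>), raising every variable to the \<open>k\<close>-th power:
  on \<open>\<Lambda>\<close>, where \<open>x\<^sub>i \<mapsto> x\<^sub>i^k\<close> amounts to \<open>p\<^sub>j \<mapsto> p\<^sub>j\<^sub>k\<close>, and on Laurent series in \<open>z\<close>
  over \<open>\<Lambda>\<close>.\<close>

definition adams :: "nat \<Rightarrow> sym \<Rightarrow> sym" where
  "adams k = sym_eval (\<lambda>c. sconst (ratfun_subst (qq ^ k) (tt ^ k) c)) (\<lambda>j. psum (j * k))"

definition adams_z :: "nat \<Rightarrow> sym fls \<Rightarrow> sym fls" where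
  "adams_z k E = fls_compose_power (Abs_fls (\<lambda>n. adams k (fls_nth E n))) k"

definition pleth :: "sym \<Rightarrow> sym \<Rightarrow> sym" where
  "pleth F E = sym_eval sconst (\<lambda>k. adams k E) F"

definition pleth_z :: "sym \<Rightarrow> sym fls \<Rightarrow> sym fls" where
  "pleth_z F E = sym_eval (\<lambda>c. fls_const (sconst c)) (\<lambda>k. adams_z k E) F"

text \<open>The alphabet \<open>X = x\<^sub>1 + x\<^sub>2 + \<dots>\<close>.\<close>

definition XX :: sym where "XX = psum 1"

text \<open>\<open>\<Omega>[E] = exp (\<Sum>k\<ge>1. p\<^sub>k[E] / k)\<close>, for \<open>E\<close> divisible by \<open>z\<close>. Then \<open>p\<^sub>k[E]\<close> is divisible by
  \<open>z^k\<close>, so only \<open>k \<le> n\<close> contribute to the coefficient of \<open>z^n\<close> in the exponent.\<close>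

definition Omega :: "sym fls \<Rightarrow> sym fps" where
  "Omega E =
     Abs_fps (\<lambda>m. sconst (1 / fact m)) oo
     Abs_fps (\<lambda>n. \<Sum>k=1..n. sconst (1 / of_nat k) * fls_nth (adams_z k E) (int n))"

text \<open>Complete homogeneous symmetric functions: \<open>\<Sum>n. h\<^sub>n z^n = \<Omega>[zX]\<close>.\<close>

definition hsym :: "nat \<Rightarrow> sym" where
  "hsym n = fps_nth (Omega (fls_X * fls_const XX)) n"

definition Dop :: "int \<Rightarrow> sym \<Rightarrow> sym" where
  "Dop k F = fls_nth
     (pleth_z F (fls_const XX + fls_const (sconst MM) * fls_X_inv) *
      fps_to_fls (Omega (- (fls_X * fls_const XX)))) k"

definition Dop_star :: "int \<Rightarrow> sym \<Rightarrow> sym" where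
  "Dop_star k F = fls_nth
     (pleth_z F (fls_const XX - fls_const (sconst MM_tilde) * fls_X_inv) *
      fps_to_fls (Omega (fls_X * fls_const XX))) k"

definition commutator :: "(sym \<Rightarrow> sym) \<Rightarrow> (sym \<Rightarrow> sym) \<Rightarrow> sym \<Rightarrow> sym" where
  "commutator A B = (\<lambda>F. A (B F) - B (A F))"

definition is_partition :: "nat list \<Rightarrow> bool" where
  "is_partition \<mu> \<longleftrightarrow> sorted_wrt (\<ge>) \<mu> \<and> 0 \<notin> set \<mu>"

definition conj_part :: "nat list \<Rightarrow> nat list" where
  "conj_part \<mu> = map (\<lambda>j. length (filter (\<lambda>r. j < r) \<mu>)) [0..<Max (insert 0 (set \<mu>))]"

definition n_stat :: "nat list \<Rightarrow> nat" where
  "n_stat \<mu> = (\<Sum>i<length \<mu>. i * \<mu> ! i)"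

definition dominated :: "nat list \<Rightarrow> nat list \<Rightarrow> bool" where
  "dominated \<nu> \<mu> \<longleftrightarrow> sum_list \<nu> = sum_list \<mu> \<and>
     (\<forall>k. sum_list (take k \<nu>) \<le> sum_list (take k \<mu>))"

text \<open>The coefficient of \<open>m\<^sub>\<nu>\<close> in the monomial expansion of \<open>F\<close>, that is, the coefficient of
  \<open>x\<^sup>\<nu>\<close> in \<open>F(x\<^sub>0, \<dots>, x\<^sub>N\<^sub>-\<^sub>1)\<close> with \<open>N\<close> the length of \<open>\<nu>\<close>. Here the type of \<open>sym\<close> is reused
  for the polynomials in the variables \<open>x\<^sub>i\<close>.\<close>

definition in_vars :: "nat \<Rightarrow> sym \<Rightarrow> (nat \<Rightarrow>\<^sub>0 nat) \<Rightarrow>\<^sub>0 ratfun" where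
  "in_vars N = sym_eval (\<lambda>c. Poly_Mapping.single 0 c)
     (\<lambda>k. \<Sum>i<N. Poly_Mapping.single (Poly_Mapping.single i k) 1)"

definition mono_coeff :: "nat list \<Rightarrow> sym \<Rightarrow> ratfun" where
  "mono_coeff \<nu> F = Poly_Mapping.lookup (in_vars (length \<nu>) F)
     (\<Sum>i<length \<nu>. Poly_Mapping.single i (\<nu> ! i))"

text \<open>Macdonald's scalar product
  \<open>\<langle>p\<^sub>\<lambda>, p\<^sub>\<mu>\<rangle> = \<delta>\<^sub>\<lambda>\<^sub>\<mu> z\<^sub>\<lambda> (\<Prod>i. (1 - q^\<lambda>\<^sub>i) / (1 - t^\<lambda>\<^sub>i))\<close>, extended bilinearly.\<close>

definition z_mono :: "(nat \<Rightarrow>\<^sub>0 nat) \<Rightarrow> nat" where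
  "z_mono m = (\<Prod>i\<in>Poly_Mapping.keys m.
     Suc i ^ Poly_Mapping.lookup m i * fact (Poly_Mapping.lookup m i))"

definition mac_inner :: "sym \<Rightarrow> sym \<Rightarrow> ratfun" where
  "mac_inner F G =
     (\<Sum>m\<in>Poly_Mapping.keys F. Poly_Mapping.lookup F m * Poly_Mapping.lookup G m *
        of_nat (z_mono m) *
        (\<Prod>i\<in>Poly_Mapping.keys m.
           ((1 - qq ^ Suc i) / (1 - tt ^ Suc i)) ^ Poly_Mapping.lookup m i))"

text \<open>The Macdonald polynomials \<open>P\<^sub>\<mu>(X;q,t)\<close> are the family with
  \<open>P\<^sub>\<mu> = m\<^sub>\<mu> + (combination of m\<^sub>\<nu> with \<nu> < \<mu> in dominance order)\<close> that is orthogonal for the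
  scalar product above; by Macdonald's theorem it exists and is unique.\<close>

definition is_Macdonald_P :: "(nat list \<Rightarrow> sym) \<Rightarrow> bool" where
  "is_Macdonald_P P \<longleftrightarrow>
     (\<forall>\<mu>. is_partition \<mu> \<longrightarrow>
        mono_coeff \<mu> (P \<mu>) = 1 \<and>
        (\<forall>\<nu>. is_partition \<nu> \<and> mono_coeff \<nu> (P \<mu>) \<noteq> 0 \<longrightarrow> dominated \<nu> \<mu>)) \<and>
     (\<forall>\<mu> \<nu>. is_partition \<mu> \<and> is_partition \<nu> \<and> \<mu> \<noteq> \<nu> \<longrightarrow> mac_inner (P \<mu>) (P \<nu>) = 0)"

text \<open>The normalisation \<open>\<Prod>s\<in>\<mu>. 1 - q^a(s) t^(l(s)+1)\<close> with arm \<open>a(s)\<close> and leg \<open>l(s)\<close>; the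
  cell \<open>(i, j)\<close> is counted from 0.\<close>

definition c_norm :: "nat list \<Rightarrow> ratfun" where
  "c_norm \<mu> = (\<Prod>i<length \<mu>. \<Prod>j<\<mu> ! i.
     1 - qq ^ (\<mu> ! i - Suc j) * tt ^ (conj_part \<mu> ! j - Suc i + 1))"

definition Macdonald_J :: "(nat list \<Rightarrow> sym) \<Rightarrow> nat list \<Rightarrow> sym" where
  "Macdonald_J P \<mu> = sym_scale (c_norm \<mu>) (P \<mu>)"

text \<open>\<open>H\<^sub>\<mu>[X;q,t] = t^n(\<mu>) J\<^sub>\<mu>[X/(1-1/t);q,1/t]\<close>; the inner map substitutes \<open>t \<mapsto> 1/t\<close> in the
  coefficients of \<open>J\<^sub>\<mu>\<close>.\<close>

definition Macdonald_H :: "(nat list \<Rightarrow> sym) \<Rightarrow> nat list \<Rightarrow> sym" where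
  "Macdonald_H P \<mu> = sym_scale (tt ^ n_stat \<mu>)
     (pleth (Poly_Mapping.map (ratfun_subst qq (1 / tt)) (Macdonald_J P \<mu>))
        (sym_scale (1 / (1 - 1 / tt)) XX))"

definition nabla :: "(nat list \<Rightarrow> sym) \<Rightarrow> sym \<Rightarrow> sym" where
  "nabla P = (THE N. Vector_Spaces.linear sym_scale sym_scale N \<and>
     (\<forall>\<mu>. is_partition \<mu> \<longrightarrow>
        N (Macdonald_H P \<mu>) =
          sym_scale (tt ^ n_stat \<mu> * qq ^ n_stat (conj_part \<mu>)) (Macdonald_H P \<mu>)))"

definition Phi :: "(nat list \<Rightarrow> sym) \<Rightarrow> nat \<Rightarrow> sym \<Rightarrow> sym" where
  "Phi P a = nabla P \<circ> Dop (int a) \<circ> inv (nabla P)"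

definition Psi :: "(nat list \<Rightarrow> sym) \<Rightarrow> nat \<Rightarrow> sym \<Rightarrow> sym" where
  "Psi P b = sym_scale (- ((qq * tt) powi (1 - int b))) \<circ>
     (nabla P \<circ> Dop_star (int b) \<circ> inv (nabla P))"

end

theory Submission
  imports Defs
begin

text \<open>
  \<open>\<nabla>\<close> is a linear bijection: the defining triangularity of the \<open>P\<^sub>\<mu>\<close> against the monomial
  functions makes them homogeneous and linearly independent, and counting partitions makes them a basis; this survives \<open>t \<mapsto> 1/t\<close> in the coefficients and the
  rescaling \<open>p\<^sub>k \<mapsto> p\<^sub>k / (1 - t^-k)\<close>, and the eigenvalues of \<open>\<nabla>\<close> are nonzero. Hence it suffices
  to compute \<open>[D\<^sub>b\<^sup>*, D\<^sub>a]\<close>.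

  Both products send \<open>F\<close> to the coefficient of \<open>z^a w^b\<close> in
  \<open>F[X + M/z - M'/w] \<Omega>[wX - zX]\<close> (where \<open>M' = M/(qt)\<close>) times the rational function
  \<open>(1 - u/t)(1 - u/q) / ((1 - u)(1 - u/(qt)))\<close> of \<open>u = z/w\<close>, expanded at \<open>u = 0\<close> and at \<open>u = \<infinity>\<close>
  respectively. The difference of the expansions is a combination of delta functions at \<open>u = 1\<close>
  and \<open>u = qt\<close>. At \<open>z = w\<close> the factor \<open>\<Omega>[wX - zX]\<close> is \<open>1\<close> and no positive power survives; at
  \<open>z = q t w\<close> the shifts of \<open>F\<close> cancel, leaving \<open>F\<close> times the coefficient of \<open>w^n\<close> in
  \<open>\<Omega>[wX(1 - qt)]\<close>.
\<close>

section \<open>Ring homomorphisms\<close>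

locale ring_morphism =
  fixes h :: "'a::comm_ring_1 \<Rightarrow> 'b::comm_ring_1"
  assumes hom_add: "h (x + y) = h x + h y"
    and hom_mult: "h (x * y) = h x * h y"
    and hom_one: "h 1 = 1"
begin

lemma hom_zero: "h 0 = 0"
  using hom_add[of 0 0] by simp

lemma hom_uminus: "h (- x) = - h x"
  using hom_add[of x "- x"] by (simp add: hom_zero eq_neg_iff_add_eq_0 add.commute)

lemma hom_diff: "h (x - y) = h x - h y"
  using hom_add[of x "- y"] by (simp add: hom_uminus)

lemma hom_sum: "h (\<Sum>i\<in>A. f i) = (\<Sum>i\<in>A. h (f i))"
  by (induction A rule: infinite_finite_induct) (simp_all add: hom_zero hom_add)

lemma hom_power: "h (x ^ n) = h x ^ n"
  by (induction n) (simp_all add: hom_one hom_mult)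

lemma hom_of_nat: "h (of_nat n) = of_nat n"
  by (induction n) (simp_all add: hom_zero hom_one hom_add)

lemmas hom_simps = hom_add hom_mult hom_one hom_zero hom_uminus hom_diff hom_sum
  hom_power hom_of_nat

end

lemma ring_morphism_comp:
  "ring_morphism f \<Longrightarrow> ring_morphism g \<Longrightarrow> ring_morphism (\<lambda>x. g (f x))"
  by (simp add: ring_morphism_def)

lemma ring_morphism_divide:
  fixes h :: "'a::field \<Rightarrow> 'b::field"
  assumes "ring_morphism h"
  shows "h (x / y) = h x / h y"
proof (cases "y = 0")
  case False
  interpret ring_morphism h by fact
  have "h (x / y) * h y = h x" "h y * h (1 / y) = 1"
    using False by (simp_all flip: hom_mult add: hom_one)
  then show ?thesis by (metis mult_zero_left nonzero_eq_divide_eq zero_neq_one)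
qed (use assms in \<open>simp add: ring_morphism.hom_zero\<close>)

lemma ring_morphism_eq_0_iff:
  fixes h :: "'a::field \<Rightarrow> 'b::field"
  assumes "ring_morphism h"
  shows "h x = 0 \<longleftrightarrow> x = 0"
  using ring_morphism_divide[OF assms, of x x] ring_morphism.hom_zero[OF assms]
    ring_morphism.hom_one[OF assms] by (cases "x = 0") auto

lemma ring_morphism_sconst: "ring_morphism sconst"
  by unfold_locales (simp_all add: sconst_def single_add mult_single)

lemma ring_morphism_pconst: "ring_morphism (\<lambda>c. [:c:])"
  by unfold_locales (simp_all add: one_pCons)

lemma ring_morphism_fls_const: "ring_morphism (fls_const :: 'a::comm_ring_1 \<Rightarrow> _)"
  by unfold_locales (simp_all add: fls_plus_const)

text \<open>Serves rational substitutions, evaluation of polynomials at 1/z, and evaluation after a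
  plethystic shift of the coefficients. The recursion on \<open>pCons\<close> reduces everything to
  the map on coefficients.\<close>

lemma ring_morphism_poly_map:
  fixes h :: "'a::comm_ring_1 \<Rightarrow> 'b::comm_ring_1"
  assumes "ring_morphism h"
  shows "ring_morphism (\<lambda>p. poly (map_poly h p) x)"
proof -
  interpret ring_morphism h by fact
  define e where "e p = poly (map_poly h p) x" for p
  have e0: "e 0 = 0" by (simp add: e_def)
  have eC: "e (pCons c p) = h c + x * e p" for c p
    by (simp add: e_def map_poly_pCons hom_zero)
  have ea: "e (p + q) = e p + e q" for p q
    by (induction p q rule: poly_induct2) (simp_all add: e0 eC hom_add algebra_simps)
  have es: "e (smult c p) = h c * e p" for c p
    by (induction p) (simp_all add: e0 eC hom_mult algebra_simps)
  have em: "e (p * q) = e p * e q" for p q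
    by (induction p) (simp_all add: e0 eC ea es hom_zero algebra_simps)
  have "e 1 = 1" by (simp add: one_pCons eC e0 hom_one)
  with ea em show ?thesis unfolding e_def by (simp add: ring_morphism_def)
qed

section \<open>Evaluation of symmetric functions\<close>

lemma poly_mapping_sum_monomials:
  "(\<Sum>m\<in>Poly_Mapping.keys F. Poly_Mapping.single m (Poly_Mapping.lookup F m)) = F"
  by (rule poly_mapping_eqI)
    (simp add: lookup_sum lookup_single when_def in_keys_iff if_distrib cong: if_cong)

text \<open>Applied both to elements of \<open>sym\<close> and to exponent vectors, which are
  finitely supported maps as well. Zero is covered as a monomial with coefficient 0.\<close>

lemma poly_mapping_additive_induct [case_names single add]:
  fixes F :: "'a \<Rightarrow>\<^sub>0 'b::comm_monoid_add"
  assumes "\<And>m c. P (Poly_Mapping.single m c)" "\<And>F G. P F \<Longrightarrow> P G \<Longrightarrow> P (F + G)"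
  shows "P F"
proof -
  have "P (\<Sum>m\<in>A. Poly_Mapping.single m (Poly_Mapping.lookup F m))" if "finite A" for A
    using that
  proof (induction A)
    case empty
    show ?case using assms(1)[of undefined 0] by simp
  qed (simp add: assms)
  from this[of "Poly_Mapping.keys F"] show ?thesis
    by (simp add: poly_mapping_sum_monomials)
qed

definition mono_eval :: "(nat \<Rightarrow> 'r::comm_ring_1) \<Rightarrow> (nat \<Rightarrow>\<^sub>0 nat) \<Rightarrow> 'r" where
  "mono_eval a m = (\<Prod>i\<in>Poly_Mapping.keys m. a (Suc i) ^ Poly_Mapping.lookup m i)"

lemma mono_eval_superset:
  assumes "finite K" "Poly_Mapping.keys m \<subseteq> K"
  shows "mono_eval a m = (\<Prod>i\<in>K. a (Suc i) ^ Poly_Mapping.lookup m i)"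
  unfolding mono_eval_def
  by (rule prod.mono_neutral_left) (use assms in \<open>auto simp: in_keys_iff\<close>)

lemma mono_eval_add: "mono_eval a (m + n) = mono_eval a m * mono_eval a n"
proof -
  let ?K = "Poly_Mapping.keys m \<union> Poly_Mapping.keys n"
  have "mono_eval a (m + n) = (\<Prod>i\<in>?K. a (Suc i) ^ Poly_Mapping.lookup (m + n) i)"
    by (rule mono_eval_superset) (auto simp: Poly_Mapping.keys_add)
  also have "\<dots> = mono_eval a m * mono_eval a n"
    by (simp add: mono_eval_superset[of ?K] lookup_add power_add prod.distrib)
  finally show ?thesis .
qed

lemma mono_eval_nonzero:
  fixes a :: "nat \<Rightarrow> 'r::idom"
  assumes "\<And>k. a (Suc k) \<noteq> 0"
  shows "mono_eval a m \<noteq> 0"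
  using assms by (simp add: mono_eval_def)

context
  fixes \<phi> :: "ratfun \<Rightarrow> 'r::comm_ring_1" and a :: "nat \<Rightarrow> 'r"
  assumes \<phi>: "ring_morphism \<phi>"
begin

interpretation ring_morphism \<phi> by (fact \<phi>)

lemma sym_eval_superset:
  assumes "finite K" "Poly_Mapping.keys F \<subseteq> K"
  shows "sym_eval \<phi> a F = (\<Sum>m\<in>K. \<phi> (Poly_Mapping.lookup F m) * mono_eval a m)"
  unfolding sym_eval_def mono_eval_def
  by (rule sum.mono_neutral_left) (use assms in \<open>auto simp: in_keys_iff hom_zero\<close>)

lemma sym_eval_single: "sym_eval \<phi> a (Poly_Mapping.single m c) = \<phi> c * mono_eval a m"
  by (subst sym_eval_superset[of "{m}"]) auto

lemma sym_eval_add: "sym_eval \<phi> a (F + G) = sym_eval \<phi> a F + sym_eval \<phi> a G"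
proof -
  let ?K = "Poly_Mapping.keys F \<union> Poly_Mapping.keys G"
  have "sym_eval \<phi> a (F + G) = (\<Sum>m\<in>?K. \<phi> (Poly_Mapping.lookup (F + G) m) * mono_eval a m)"
    by (rule sym_eval_superset) (auto simp: Poly_Mapping.keys_add)
  then show ?thesis
    by (simp add: sym_eval_superset[of ?K] lookup_add hom_add sum.distrib algebra_simps)
qed

lemma sym_eval_mult: "sym_eval \<phi> a (F * G) = sym_eval \<phi> a F * sym_eval \<phi> a G"
proof (induction F rule: poly_mapping_additive_induct)
  case (single m c)
  show ?case
    by (induction G rule: poly_mapping_additive_induct)
      (simp_all add: mult_single sym_eval_single sym_eval_add mono_eval_add hom_mult algebra_simps)
qed (simp add: sym_eval_add algebra_simps)

text \<open>The universal property of a polynomial ring: the power sums may be sent anywhere.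
  \<open>adams\<close>, \<open>pleth\<close>, \<open>pleth_z\<close> and \<open>in_vars\<close> are
  instances.\<close>

lemma ring_morphism_sym_eval: "ring_morphism (sym_eval \<phi> a)"
proof
  have "sym_eval \<phi> a (Poly_Mapping.single 0 1) = 1"
    by (simp only: sym_eval_single) (simp add: mono_eval_def hom_one)
  then show "sym_eval \<phi> a 1 = 1" by simp
qed (simp_all add: sym_eval_add sym_eval_mult)

lemma sym_eval_sconst: "sym_eval \<phi> a (sconst c) = \<phi> c"
  by (simp add: sconst_def sym_eval_single mono_eval_def)

lemma sym_eval_psum: "k > 0 \<Longrightarrow> sym_eval \<phi> a (psum k) = a k"
  by (simp add: psum_def sym_eval_single mono_eval_def hom_one)

end

lemma sym_induct [case_names sconst psum add mult]:
  assumes "\<And>c. P (sconst c)" "\<And>k. k > 0 \<Longrightarrow> P (psum k)"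
    and add: "\<And>F G. P F \<Longrightarrow> P G \<Longrightarrow> P (F + G)" and mult: "\<And>F G. P F \<Longrightarrow> P G \<Longrightarrow> P (F * G)"
  shows "P F"
proof (induction F rule: poly_mapping_additive_induct)
  case (single m c)
  have one: "P 1" using assms(1)[of 1] by (simp add: sconst_def)
  have pow: "P (Poly_Mapping.single (Poly_Mapping.single i n) 1)" for i n
  proof (induction n)
    case (Suc n)
    have "Poly_Mapping.single (Poly_Mapping.single i (Suc n)) 1 =
        psum (Suc i) * Poly_Mapping.single (Poly_Mapping.single i n) (1::ratfun)"
      by (simp add: psum_def mult_single flip: single_add)
    then show ?case using mult[OF assms(2)[of "Suc i"] Suc] by simp
  qed (simp add: one)
  have "P (Poly_Mapping.single m 1)"
  proof (induction m rule: poly_mapping_additive_induct)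
    case (add m n)
    then show ?case using mult[OF add] by (simp add: mult_single)
  qed (rule pow)
  from mult[OF assms(1)[of c] this] show ?case by (simp add: sconst_def mult_single)
qed (rule add)

text \<open>The uniqueness half of the universal property: identities between plethystic
  substitutions need checking only on scalars and power sums.\<close>

lemma ring_morphism_sym_eqI:
  assumes "ring_morphism f" "ring_morphism g"
    and "\<And>c. f (sconst c) = g (sconst c)" "\<And>k. k > 0 \<Longrightarrow> f (psum k) = g (psum k)"
  shows "f F = g F"
  by (induction F rule: sym_induct)
    (simp_all add: assms(3,4) ring_morphism.hom_add[OF assms(1)] ring_morphism.hom_add[OF assms(2)]
      ring_morphism.hom_mult[OF assms(1)] ring_morphism.hom_mult[OF assms(2)])

section \<open>Exponential series\<close>

text \<open>\<open>f = exp (\<Sum>k\<ge>1. g k z^k / k)\<close>, characterised by its logarithmic derivative so that no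
  division is needed.\<close>

definition exp_series :: "(nat \<Rightarrow> 'a::comm_ring_1) \<Rightarrow> 'a fps \<Rightarrow> bool" where
  "exp_series g f \<longleftrightarrow> fps_nth f 0 = 1 \<and> fps_deriv f = Abs_fps (\<lambda>k. g (Suc k)) * f"

lemma exp_series_iff:
  "exp_series g f \<longleftrightarrow> fps_nth f 0 = 1 \<and>
    (\<forall>n. of_nat (Suc n) * fps_nth f (Suc n) = (\<Sum>i=0..n. g (Suc i) * fps_nth f (n - i)))"
  by (simp add: exp_series_def fps_eq_iff fps_mult_nth del: of_nat_Suc)

text \<open>The differential equation expresses (m + 1) times the coefficient of index m + 1 through
  earlier coefficients, and m + 1 can be cancelled in a domain of characteristic 0.\<close>

lemma exp_series_unique:
  fixes f f' :: "'a::{idom, ring_char_0} fps"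
  assumes "exp_series g f" "exp_series g f'"
  shows "f = f'"
proof (rule fps_ext)
  fix n
  show "fps_nth f n = fps_nth f' n"
  proof (induction n rule: less_induct)
    case (less n)
    show ?case
    proof (cases n)
      case (Suc m)
      have *: "of_nat (Suc m) * fps_nth F (Suc m) = (\<Sum>i=0..m. g (Suc i) * fps_nth F (m - i))"
        if "exp_series g F" for F
        using that by (simp only: exp_series_iff)
      have "of_nat (Suc m) * fps_nth f (Suc m) = of_nat (Suc m) * fps_nth f' (Suc m)"
        unfolding *[OF assms(1)] *[OF assms(2)] using less Suc by (intro sum.cong) auto
      then show ?thesis using Suc by (simp del: of_nat_Suc)
    qed (use assms in \<open>simp add: exp_series_def\<close>)
  qed
qed

lemma exp_series_mult:
  assumes "exp_series g f" "exp_series g' f'"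
  shows "exp_series (\<lambda>k. g k + g' k) (f * f')"
proof -
  have "Abs_fps (\<lambda>k. g (Suc k) + g' (Suc k)) = Abs_fps (\<lambda>k. g (Suc k)) + Abs_fps (\<lambda>k. g' (Suc k))"
    by (simp add: fps_eq_iff)
  then show ?thesis using assms by (simp add: exp_series_def algebra_simps)
qed

text \<open>The recurrence between the coefficients involves no division, so it passes through every
  ring homomorphism.\<close>

lemma exp_series_hom:
  assumes "ring_morphism h" "exp_series g f"
  shows "exp_series (\<lambda>k. h (g k)) (Abs_fps (\<lambda>n. h (fps_nth f n)))"
proof -
  interpret ring_morphism h by fact
  have "h (of_nat (Suc n) * fps_nth f (Suc n)) = h (\<Sum>i=0..n. g (Suc i) * fps_nth f (n - i))" for n
    using assms(2) by (simp only: exp_series_iff)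
  then have "of_nat (Suc n) * h (fps_nth f (Suc n)) = (\<Sum>i=0..n. h (g (Suc i)) * h (fps_nth f (n - i)))"
    for n by (simp only: hom_mult hom_of_nat hom_sum)
  then show ?thesis using assms(2)
    by (simp add: exp_series_iff hom_one del: of_nat_Suc)
qed

text \<open>Substituting x z for z multiplies the term of degree k in the exponent by x^k.\<close>

lemma exp_series_scale:
  assumes "exp_series g f"
  shows "exp_series (\<lambda>k. x ^ k * g k) (Abs_fps (\<lambda>n. x ^ n * fps_nth f n))"
proof -
  have *: "of_nat (Suc n) * fps_nth f (Suc n) = (\<Sum>i=0..n. g (Suc i) * fps_nth f (n - i))" for n
    using assms by (simp only: exp_series_iff)
  have "of_nat (Suc n) * (x ^ Suc n * fps_nth f (Suc n)) =
      (\<Sum>i=0..n. (x ^ Suc i * g (Suc i)) * (x ^ (n - i) * fps_nth f (n - i)))" for n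
  proof -
    have "(\<Sum>i=0..n. (x ^ Suc i * g (Suc i)) * (x ^ (n - i) * fps_nth f (n - i))) =
        (\<Sum>i=0..n. x ^ Suc n * (g (Suc i) * fps_nth f (n - i)))"
    proof (rule sum.cong)
      fix i assume "i \<in> {0..n}"
      then have "x ^ Suc n = x ^ Suc i * x ^ (n - i)" by (simp add: mult.assoc flip: power_add)
      then show "(x ^ Suc i * g (Suc i)) * (x ^ (n - i) * fps_nth f (n - i)) =
          x ^ Suc n * (g (Suc i) * fps_nth f (n - i))"
        by (simp only: ac_simps)
    qed simp
    also have "\<dots> = x ^ Suc n * (\<Sum>i=0..n. g (Suc i) * fps_nth f (n - i))"
      by (simp only: sum_distrib_left)
    finally show ?thesis unfolding *[symmetric] by (simp only: ac_simps)
  qed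
  then show ?thesis using assms
    by (simp add: exp_series_iff del: of_nat_Suc power_Suc)
qed

lemma exp_series_one: "exp_series (\<lambda>k. 0) 1"
  by (simp add: exp_series_def fps_eq_iff fps_mult_nth)

text \<open>This is the expansion of log(1 - x z).\<close>

lemma exp_series_linear: "exp_series (\<lambda>k. - (x ^ k)) (1 - fps_const x * fps_X)"
proof -
  have "Abs_fps (\<lambda>k. - (x ^ Suc k)) * (1 - fps_const x * fps_X) = - fps_const x"
  proof (rule fps_ext)
    fix n
    have "Abs_fps (\<lambda>k. - (x ^ Suc k)) * (1 - fps_const x * fps_X) =
        Abs_fps (\<lambda>k. - (x ^ Suc k)) - fps_X * (fps_const x * Abs_fps (\<lambda>k. - (x ^ Suc k)))"
      by (simp add: algebra_simps)
    then show "fps_nth (Abs_fps (\<lambda>k. - (x ^ Suc k)) * (1 - fps_const x * fps_X)) n =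
        fps_nth (- fps_const x) n"
      by (cases n) simp_all
  qed
  then show ?thesis by (simp add: exp_series_def)
qed

text \<open>The partial fraction expansion of \<open>(1 - x z)(1 - y z) / ((1 - z)(1 - x y z))\<close>.\<close>

definition pf_coeff :: "'a::field \<Rightarrow> 'a \<Rightarrow> nat \<Rightarrow> 'a" where
  "pf_coeff x y l = (if l = 0 then 1 else (1 - x) * (1 - y) / (1 - x * y) * (1 - (x * y) ^ l))"

text \<open>A factor 1 - c z contributes - c^k to the exponent, so the quotient has 1 - x^k - y^k +
  (x y)^k, which factors. The hypothesis keeps the two poles apart.\<close>

lemma exp_series_pf_coeff:
  fixes x y :: "'a::field_char_0"
  assumes "x * y \<noteq> 1"
  shows "exp_series (\<lambda>k. (1 - x ^ k) * (1 - y ^ k)) (Abs_fps (pf_coeff x y))"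
proof -
  let ?L = "\<lambda>x::'a. 1 - fps_const x * fps_X"
  let ?C = "Abs_fps (pf_coeff x y)"
  have C: "?C * (?L 1 * ?L (x * y)) = ?L x * ?L y"
  proof (rule fps_ext)
    fix n
    have e: "?C * (?L 1 * ?L (x * y)) = ?C - fps_X * (fps_const (1 + x * y) * ?C)
        + fps_X * (fps_X * (fps_const (x * y) * ?C))"
      by (simp add: algebra_simps flip: fps_const_add)
    have e': "?L x * ?L y = 1 - fps_const (x + y) * fps_X + fps_X * (fps_X * fps_const (x * y))"
      by (simp add: algebra_simps flip: fps_const_add fps_const_mult)
    \<comment> \<open>\<open>pf_coeff x y 0\<close> is 1, whereas the general formula would give 0
      there. The three-term recurrence is therefore uniform only from index 3 on, where the
      quadratic numerator has ended too.\<close>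
    consider "n = 0" | "n = 1" | "n = 2" | k where "n = Suc (Suc (Suc k))"
      by (metis One_nat_def Suc_1 not0_implies_Suc)
    then show "fps_nth (?C * (?L 1 * ?L (x * y))) n = fps_nth (?L x * ?L y) n"
      unfolding e e' using assms
      by cases (simp_all add: pf_coeff_def divide_simps numeral_2_eq_2, (simp add: algebra_simps)+)
  qed
  define D N where "D = ?L 1 * ?L (x * y)" and "N = ?L x * ?L y"
  define GD GN where "GD = Abs_fps (\<lambda>k. - (1 ^ Suc k) + - ((x * y) ^ Suc k))"
    and "GN = Abs_fps (\<lambda>k. - (x ^ Suc k) + - (y ^ Suc k))"
  have D: "fps_deriv D = GD * D" and N: "fps_deriv N = GN * N"
    using exp_series_mult[OF exp_series_linear[of 1] exp_series_linear[of "x * y"]]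
      exp_series_mult[OF exp_series_linear[of x] exp_series_linear[of y]]
    unfolding exp_series_def D_def N_def GD_def GN_def by blast+
  have CD: "?C * D = N" using C unfolding D_def N_def .
  \<comment> \<open>Differentiating \<open>?C * D = N\<close> and cancelling \<open>D\<close>, whose
    constant term is 1, gives the logarithmic derivative of \<open>?C\<close> as a
    difference.\<close>
  have "?C * fps_deriv D + fps_deriv ?C * D = fps_deriv N"
    unfolding CD[symmetric] fps_deriv_mult ..
  then have "fps_deriv ?C * D + ?C * (GD * D) = GN * (?C * D)"
    unfolding D N CD by (simp only: add.commute)
  then have "fps_deriv ?C * D = ((GN - GD) * ?C) * D" by (simp add: algebra_simps)
  moreover have "fps_nth D 0 = 1" by (simp add: D_def)
  then have "D \<noteq> 0" by auto
  ultimately have "fps_deriv ?C = (GN - GD) * ?C" using mult_right_cancel by blast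
  moreover have "GN - GD = Abs_fps (\<lambda>k. (1 - x ^ Suc k) * (1 - y ^ Suc k))"
    by (rule fps_ext) (simp add: GN_def GD_def algebra_simps power_mult_distrib)
  ultimately show ?thesis by (simp add: exp_series_def pf_coeff_def)
qed

section \<open>Substitution in rational functions\<close>

lemma ring_morphism_to_fract: "ring_morphism (to_fract :: 'a::idom \<Rightarrow> _)"
  by unfold_locales simp_all

lemma ring_morphism_of_rat: "ring_morphism (of_rat :: rat \<Rightarrow> 'a::field_char_0)"
  by unfold_locales (simp_all add: of_rat_add of_rat_mult)

lemma ring_morphism_bipoly_eval: "ring_morphism (bipoly_eval a b)"
  unfolding bipoly_eval_def[abs_def]
  by (intro ring_morphism_poly_map ring_morphism_of_rat)

section \<open>Raising q and t to powers, and inverting t\<close>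

lemma qq_eq: "qq = to_fract [:[:0, 1:]:]" and tt_eq: "tt = to_fract [:0, 1:]"
  by (simp_all add: qq_def tt_def to_fract_def)

text \<open>Both embeddings of the rationals agree on integers, hence on quotients of
  integers.\<close>

lemma of_rat_ratfun: "(of_rat c :: ratfun) = to_fract [:[:c:]:]"
proof (cases c)
  case (Fract i j)
  interpret ring_morphism "\<lambda>c. to_fract [:[:c:]:] :: ratfun"
    by (rule ring_morphism_comp[OF ring_morphism_comp[OF ring_morphism_pconst ring_morphism_pconst]
          ring_morphism_to_fract])
  have hom_int: "to_fract [:[:of_int i:]:] = (of_int i :: ratfun)" for i
    by (cases i rule: int_cases2) (simp_all only: of_int_of_nat_eq of_int_minus hom_of_nat hom_uminus)
  have "to_fract [:[:c:]:] * (of_int j :: ratfun) = to_fract [:[:c * of_int j:]:]"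
    unfolding hom_int[symmetric] hom_mult ..
  also have "c * of_int j = of_int i"
    using Fract by (simp add: Fract_of_int_quotient)
  finally have "to_fract [:[:c:]:] * (of_int j :: ratfun) = of_int i" by (simp only: hom_int)
  then show ?thesis using Fract by (simp add: of_rat_rat field_simps)
qed

lemma inner_eval_qq_power:
  "poly (map_poly of_rat c) (qq ^ k) = to_fract [:pcompose c (monom 1 k):]"
proof (induction c)
  case (pCons x c)
  have "qq ^ k = to_fract [:monom 1 k:]"
    by (simp only: qq_eq monom_altdef flip: ring_morphism.hom_power[OF ring_morphism_to_fract]
        ring_morphism.hom_power[OF ring_morphism_pconst]) simp
  then show ?case
    using pCons by (simp add: map_poly_pCons pcompose_pCons of_rat_ratfun flip: to_fract_add to_fract_mult)
qed simp

text \<open>Power substitutions create no denominators: they are compositions with monomials, whose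
  injectivity is visible from degrees.\<close>

lemma bipoly_eval_power:
  "bipoly_eval (qq ^ k) (tt ^ k) f =
    to_fract (pcompose (map_poly (\<lambda>c. pcompose c (monom 1 k)) f) (monom 1 k))"
proof (induction f)
  case (pCons c f)
  have "tt ^ k = to_fract (monom 1 k)"
    by (simp only: tt_eq monom_altdef flip: ring_morphism.hom_power[OF ring_morphism_to_fract]) simp
  moreover have "bipoly_eval a b (pCons c f) = poly (map_poly of_rat c) a + b * bipoly_eval a b f" for a b
    by (simp add: bipoly_eval_def map_poly_pCons)
  ultimately show ?case
    using pCons by (simp add: map_poly_pCons pcompose_pCons inner_eval_qq_power
        flip: to_fract_add to_fract_mult)
qed (simp add: bipoly_eval_def)

definition alg_indep :: "ratfun \<Rightarrow> ratfun \<Rightarrow> bool" where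
  "alg_indep a b \<longleftrightarrow> (\<forall>f. bipoly_eval a b f = 0 \<longrightarrow> f = 0)"

lemma alg_indep_power:
  assumes "k > 0"
  shows "alg_indep (qq ^ k) (tt ^ k)"
  unfolding alg_indep_def
proof (intro allI impI)
  fix f assume "bipoly_eval (qq ^ k) (tt ^ k) f = 0"
  then have "map_poly (\<lambda>c. pcompose c (monom 1 k)) f = 0"
    using assms by (simp add: bipoly_eval_power pcompose_eq_0_iff degree_monom_eq)
  then show "f = 0"
    using assms by (subst (asm) map_poly_eq_0_iff) (auto simp: pcompose_eq_0_iff degree_monom_eq)
qed

lemma bipoly_eval_qq_tt: "bipoly_eval qq tt f = to_fract f"
  using bipoly_eval_power[of 1 f] by (simp add: monom_altdef map_poly_idI)

text \<open>Multiplying f(q, 1/t) by the power of t given by the degree reverses the coefficients of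
  f in t, and the reversed polynomial vanishes only if f does.\<close>

lemma alg_indep_inverse: "alg_indep qq (1 / tt)"
  unfolding alg_indep_def
proof (intro allI impI)
  fix f assume *: "bipoly_eval qq (1 / tt) f = 0"
  let ?h = "\<lambda>c. poly (map_poly of_rat c) qq"
  have h0: "?h c = 0 \<longleftrightarrow> c = 0" for c
    using inner_eval_qq_power[of c 1] by (simp add: monom_altdef)
  have "tt \<noteq> 0" by (simp add: tt_eq)
  \<comment> \<open>Reversal depends on the degree, which the coefficient map preserves because it
    kills only 0.\<close>
  have "map_poly ?h (reflect_poly f) = reflect_poly (map_poly ?h f)"
    by (rule poly_eqI) (simp add: coeff_map_poly coeff_reflect_poly degree_map_poly h0)
  then have "to_fract (reflect_poly f) = tt ^ degree (map_poly ?h f) * bipoly_eval qq (1 / tt) f"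
    using poly_reflect_poly_nz[OF \<open>tt \<noteq> 0\<close>, of "map_poly ?h f"]
    by (simp add: bipoly_eval_def inverse_eq_divide flip: bipoly_eval_qq_tt)
  then show "f = 0" using * by simp
qed

text \<open>Algebraic independence keeps all denominators nonzero, and cross-multiplication then
  shows that the value does not depend on the chosen fraction.\<close>

lemma ratfun_subst_Fract:
  assumes "alg_indep a b" "g \<noteq> 0"
  shows "ratfun_subst a b (Fract f g) = bipoly_eval a b f / bipoly_eval a b g"
  unfolding ratfun_subst_def
proof (rule the_equality)
  interpret ring_morphism "bipoly_eval a b" by (rule ring_morphism_bipoly_eval)
  fix y assume "\<exists>f' g'. g' \<noteq> 0 \<and> Fract f g = Fract f' g' \<and> y = bipoly_eval a b f' / bipoly_eval a b g'"
  then obtain f' g' where *: "g' \<noteq> 0" "Fract f g = Fract f' g'"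
    "y = bipoly_eval a b f' / bipoly_eval a b g'" by blast
  then have "bipoly_eval a b (f * g') = bipoly_eval a b (f' * g)"
    using assms(2) by (simp add: eq_fract)
  moreover have "bipoly_eval a b g \<noteq> 0" "bipoly_eval a b g' \<noteq> 0"
    using assms * by (auto simp: alg_indep_def)
  ultimately show "y = bipoly_eval a b f / bipoly_eval a b g"
    by (simp add: * hom_mult frac_eq_eq)
qed (use assms in auto)

lemma ring_morphism_ratfun_subst:
  assumes "alg_indep a b"
  shows "ring_morphism (ratfun_subst a b)"
proof
  interpret ring_morphism "bipoly_eval a b" by (rule ring_morphism_bipoly_eval)
  have nz: "bipoly_eval a b g \<noteq> 0" if "g \<noteq> 0" for g using assms that by (auto simp: alg_indep_def)
  show "ratfun_subst a b (x + y) = ratfun_subst a b x + ratfun_subst a b y" for x y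
    by (cases x; cases y) (simp add: ratfun_subst_Fract assms nz hom_simps field_simps)
  show "ratfun_subst a b (x * y) = ratfun_subst a b x * ratfun_subst a b y" for x y
    by (cases x; cases y) (simp add: ratfun_subst_Fract assms nz hom_simps field_simps)
  show "ratfun_subst a b 1 = 1"
    by (simp add: One_fract_def ratfun_subst_Fract assms hom_one)
qed

lemma ratfun_subst_qq: "alg_indep a b \<Longrightarrow> ratfun_subst a b qq = a"
  and ratfun_subst_tt: "alg_indep a b \<Longrightarrow> ratfun_subst a b tt = b"
  by (simp_all add: qq_def tt_def ratfun_subst_Fract bipoly_eval_def map_poly_pCons)

text \<open>The source of the nonvanishing facts about qt - 1, \<open>MM\<close>,
  \<open>c_norm\<close> and 1 - t^(-k).\<close>

lemma qq_tt_power_eq_1_iff: "qq ^ i * tt ^ j = 1 \<longleftrightarrow> i = 0 \<and> j = 0"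
proof
  assume "qq ^ i * tt ^ j = 1"
  moreover have "qq ^ i * tt ^ j = to_fract (monom (monom 1 i) j)"
  proof -
    have "monom (monom 1 i) j = [:[:0, 1:]:] ^ i * ([:0, 1:] ^ j :: rat poly poly)"
      by (simp only: monom_altdef flip: ring_morphism.hom_power[OF ring_morphism_pconst]) simp
    then show ?thesis
      by (simp add: qq_eq tt_eq ring_morphism.hom_power[OF ring_morphism_to_fract])
  qed
  ultimately have "monom (monom 1 i) j = (1 :: rat poly poly)"
    using to_fract_eq_iff[of _ "1 :: rat poly poly"] by simp
  then have "coeff (coeff (monom (monom (1::rat) i) j) j) i = coeff (coeff 1 j) i" by simp
  then show "i = 0 \<and> j = 0" by (cases "j = 0"; cases "i = 0") simp_all
qed simp

lemma qq_nz: "qq \<noteq> 0" and tt_nz: "tt \<noteq> 0"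
  by (simp_all add: qq_eq tt_eq)

lemma qt_neq_1: "qq * tt \<noteq> 1"
  using qq_tt_power_eq_1_iff[of 1 1] by simp

section \<open>Plethystic shifts as ring homomorphisms\<close>

abbreviation psi :: "nat \<Rightarrow> ratfun \<Rightarrow> ratfun" where
  "psi k \<equiv> ratfun_subst (qq ^ k) (tt ^ k)"

lemma ring_morphism_psi: "k > 0 \<Longrightarrow> ring_morphism (psi k)"
  by (intro ring_morphism_ratfun_subst alg_indep_power)

lemma psi_qq: "k > 0 \<Longrightarrow> psi k qq = qq ^ k" and psi_tt: "k > 0 \<Longrightarrow> psi k tt = tt ^ k"
  by (simp_all add: ratfun_subst_qq ratfun_subst_tt alg_indep_power)

lemmas psi_simps = psi_qq psi_tt ring_morphism.hom_simps[OF ring_morphism_psi]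
  ring_morphism_divide[OF ring_morphism_psi]

lemma ring_morphism_adams:
  assumes "k > 0"
  shows "ring_morphism (adams k)"
  unfolding adams_def
  by (intro ring_morphism_sym_eval ring_morphism_comp[OF ring_morphism_psi ring_morphism_sconst] assms)

lemma adams_sconst: "k > 0 \<Longrightarrow> adams k (sconst c) = sconst (psi k c)"
  unfolding adams_def
  by (intro sym_eval_sconst ring_morphism_comp[OF ring_morphism_psi ring_morphism_sconst])

lemma adams_XX: "k > 0 \<Longrightarrow> adams k XX = psum k"
  unfolding adams_def XX_def
  by (subst sym_eval_psum) (simp_all add: ring_morphism_comp[OF ring_morphism_psi ring_morphism_sconst])

lemma adams_z_nth:
  assumes "k > 0"
  shows "fls_nth (adams_z k E) n = (if int k dvd n then adams k (fls_nth E (n div int k)) else 0)"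
proof -
  \<comment> \<open>\<open>Abs_fls\<close> returns its argument faithfully only for sequences
    vanishing below some index; the subdegree of \<open>E\<close> is such a bound, since
    \<open>adams k\<close> fixes 0.\<close>
  have "fls_nth (Abs_fls (\<lambda>n. adams k (fls_nth E n))) m = adams k (fls_nth E m)" for m
    by (rule nth_Abs_fls_lower_bound[of "fls_subdegree E"])
      (simp add: ring_morphism.hom_zero[OF ring_morphism_adams[OF assms]])
  then show ?thesis
    using assms by (simp add: adams_z_def fls_nth_compose_power)
qed

lemma adams_z_shift:
  assumes "k > 0"
  shows "adams_z k (fls_const XX + fls_const (sconst c) * fls_X_inv) =
    fls_const (psum k) + fls_const (sconst (psi k c)) * fls_X_inv ^ k"
proof (rule fls_eqI)
  fix n
  interpret ring_morphism "adams k" by (rule ring_morphism_adams[OF assms])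
  have "fls_nth (fls_const XX + fls_const (sconst c) * fls_X_inv) i =
      (if i = 0 then XX else if i = -1 then sconst c else 0)" for i
    by (simp add: fls_X_inv_conv_shift_1)
  moreover have "n div int k = - 1 \<and> int k dvd n \<longleftrightarrow> n = - int k" "n div int k = 0 \<and> int k dvd n \<longleftrightarrow> n = 0"
    using assms by (auto simp: zdiv_zminus1_eq_if)
  moreover have "fls_nth (fls_const (psum k) + fls_const (sconst (psi k c)) * fls_X_inv ^ k) n =
      (if n = 0 then psum k else if n = - int k then sconst (psi k c) else 0)"
    using assms by (simp add: fls_X_inv_power_conv_shift_1)
  ultimately show "fls_nth (adams_z k (fls_const XX + fls_const (sconst c) * fls_X_inv)) n =
    fls_nth (fls_const (psum k) + fls_const (sconst (psi k c)) * fls_X_inv ^ k) n"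
    using assms by (auto simp: adams_z_nth adams_XX adams_sconst hom_zero)
qed

text \<open>The polynomial variable stands for \<open>1/z\<close>.\<close>

definition shift_hom :: "(nat \<Rightarrow> ratfun) \<Rightarrow> sym \<Rightarrow> sym poly" where
  "shift_hom m = sym_eval (\<lambda>c. [:sconst c:]) (\<lambda>k. [:psum k:] + monom (sconst (m k)) k)"

lemma ring_morphism_sconst_poly: "ring_morphism (\<lambda>c. [:sconst c:])"
  by (rule ring_morphism_comp[OF ring_morphism_sconst ring_morphism_pconst])

lemma ring_morphism_shift_hom: "ring_morphism (shift_hom m)"
  unfolding shift_hom_def by (intro ring_morphism_sym_eval ring_morphism_sconst_poly)

lemma shift_hom_sconst: "shift_hom m (sconst c) = [:sconst c:]"
  unfolding shift_hom_def by (intro sym_eval_sconst ring_morphism_sconst_poly)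

lemma shift_hom_psum: "k > 0 \<Longrightarrow> shift_hom m (psum k) = [:psum k:] + monom (sconst (m k)) k"
  unfolding shift_hom_def by (intro sym_eval_psum ring_morphism_sconst_poly)

text \<open>F[X + c/z] is a polynomial in 1/z. Working in \<open>sym poly\<close> instead of Laurent
  series gives finite sums bounded by a degree.\<close>

lemma pleth_z_shift:
  assumes "\<And>k. k > 0 \<Longrightarrow> psi k c = m k"
  shows "pleth_z F (fls_const XX + fls_const (sconst c) * fls_X_inv) =
    poly (map_poly fls_const (shift_hom m F)) fls_X_inv"
proof (rule ring_morphism_sym_eqI)
  have phi: "ring_morphism (\<lambda>c. fls_const (sconst c))"
    by (rule ring_morphism_comp[OF ring_morphism_sconst ring_morphism_fls_const])
  let ?E = "fls_const XX + fls_const (sconst c) * fls_X_inv"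
  show "ring_morphism (\<lambda>F. pleth_z F ?E)"
    unfolding pleth_z_def by (intro ring_morphism_sym_eval phi)
  show "ring_morphism (\<lambda>F. poly (map_poly fls_const (shift_hom m F)) fls_X_inv)"
    by (intro ring_morphism_comp[OF ring_morphism_shift_hom]
        ring_morphism_poly_map ring_morphism_fls_const)
  show "pleth_z (sconst d) ?E = poly (map_poly fls_const (shift_hom m (sconst d))) fls_X_inv" for d
    by (simp add: pleth_z_def sym_eval_sconst[OF phi] shift_hom_sconst map_poly_pCons)
  show "pleth_z (psum k) ?E = poly (map_poly fls_const (shift_hom m (psum k))) fls_X_inv" if "k > 0" for k
  proof -
    interpret e: ring_morphism "\<lambda>p. poly (map_poly fls_const p) (fls_X_inv :: sym fls)"
      by (intro ring_morphism_poly_map ring_morphism_fls_const)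
    show ?thesis
      using that by (simp add: pleth_z_def sym_eval_psum[OF phi] shift_hom_psum e.hom_add
          map_poly_pCons map_poly_monom poly_monom adams_z_shift assms)
  qed
qed

lemma fls_nth_poly_inv_mult:
  fixes p :: "'a::comm_ring_1 poly"
  shows "fls_nth (poly (map_poly fls_const p) fls_X_inv * fps_to_fls G) (int a) =
    (\<Sum>j\<le>degree p. coeff p j * fps_nth G (a + j))"
proof -
  have deg: "degree (map_poly fls_const p :: 'a fls poly) = degree p"
    by (rule degree_map_poly) simp
  have "fls_nth (fls_const x * fls_X_inv ^ j * fps_to_fls G) (int a) = x * fps_nth G (a + j)" for x j
    unfolding mult.assoc by (simp add: fls_X_inv_power_times_conv_shift nat_add_distrib)
  then show ?thesis
    by (simp add: poly_altdef deg coeff_map_poly sum_distrib_right fls_nth_sum)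
qed

text \<open>The scalar s must be unaffected by raising q and t to powers. In particular p_k[-zX] = -
  z^k p_k: the sign is a scalar and is not raised to the k-th power.\<close>

lemma exp_series_Omega:
  assumes "E = fls_X * fls_const (sconst s * XX)" "\<And>k. k > 0 \<Longrightarrow> psi k s = s"
  shows "exp_series (\<lambda>k. sconst s * psum k) (Omega E)"
proof -
  define ex where "ex = Abs_fps (\<lambda>m. sconst (1 / fact m))"
  define S where "S = Abs_fps (\<lambda>n. \<Sum>k=1..n. sconst (1 / of_nat k) * fls_nth (adams_z k E) (int n))"
  interpret s: ring_morphism sconst by (rule ring_morphism_sconst)
  have E: "fls_nth E i = (if i = 1 then sconst s * XX else 0)" for i
    by (simp add: assms(1) fls_X_conv_shift_1)
  \<comment> \<open>\<open>E\<close> has a single coefficient, at z, which \<open>adams_z k\<close>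
    moves to z^k; hence only k = n survives in the exponent.\<close>
  have az: "fls_nth (adams_z k E) (int n) = (if k = n then sconst s * psum n else 0)"
    if k: "k > 0" for k n
  proof -
    interpret ring_morphism "adams k" by (rule ring_morphism_adams[OF k])
    have "int n div int k = 1 \<and> int k dvd int n \<longleftrightarrow> k = n" using k by auto
    moreover have "adams k (sconst s * XX) = sconst s * psum k"
      using k by (simp add: hom_mult adams_sconst adams_XX assms(2))
    ultimately show ?thesis
      using k by (auto simp: adams_z_nth E hom_zero)
  qed
  have S: "fps_nth S n = (if n = 0 then 0 else sconst (1 / of_nat n) * (sconst s * psum n))" for n
  proof -
    have "fps_nth S n = (\<Sum>k=1..n. if k = n then sconst (1 / of_nat n) * (sconst s * psum n) else 0)"
      unfolding S_def fps_nth_Abs_fps by (rule sum.cong) (auto simp: az)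
    then show ?thesis by auto
  qed
  have inv: "of_nat (Suc n) * sconst (1 / of_nat (Suc n)) = 1" for n
    by (simp only: s.hom_of_nat[symmetric] s.hom_mult[symmetric] s.hom_one[symmetric])
      (simp del: of_nat_Suc)
  have "fps_deriv S = Abs_fps (\<lambda>k. sconst s * psum (Suc k))"
    by (rule fps_ext) (simp add: S inv mult.assoc[symmetric] del: of_nat_Suc)
  moreover have "fps_deriv ex = ex"
  proof (rule fps_ext)
    fix n
    have "of_nat (Suc n) * sconst (1 / fact (Suc n)) = sconst (1 / fact n)"
      by (simp only: s.hom_of_nat[symmetric] s.hom_mult[symmetric]) (simp del: of_nat_Suc add: fact_Suc)
    then show "fps_nth (fps_deriv ex) n = fps_nth ex n" by (simp add: ex_def del: of_nat_Suc fact_Suc)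
  qed
  moreover have "fps_nth S 0 = 0" by (simp add: S)
  ultimately have "fps_deriv (ex oo S) = Abs_fps (\<lambda>k. sconst s * psum (Suc k)) * (ex oo S)"
    by (simp add: fps_compose_deriv)
  moreover have "fps_nth (ex oo S) 0 = 1" by (simp add: ex_def s.hom_one)
  ultimately show ?thesis by (simp add: Omega_def ex_def S_def exp_series_def)
qed

text \<open>These are the generating series of (-1)^n e_n and of h_n.\<close>

definition E_series :: "sym fps" where "E_series = Omega (- (fls_X * fls_const XX))"
definition H_series :: "sym fps" where "H_series = Omega (fls_X * fls_const XX)"

lemma exp_series_E: "exp_series (\<lambda>k. - psum k) E_series"
proof -
  interpret s: ring_morphism sconst by (rule ring_morphism_sconst)
  have "- (fls_X * fls_const XX) = fls_X * fls_const (sconst (-1) * XX)"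
    by (simp add: s.hom_uminus s.hom_one)
  from exp_series_Omega[OF this] show ?thesis
    by (simp add: E_series_def psi_simps s.hom_uminus s.hom_one)
qed

lemma exp_series_H: "exp_series psum H_series"
  using exp_series_Omega[of "fls_X * fls_const XX" 1]
  by (simp add: H_series_def psi_simps ring_morphism.hom_simps[OF ring_morphism_sconst])

text \<open>The values p_k[M] and p_k[-M'] with M' = M/(qt). The sign is included so that both
  operators shift X by addition.\<close>

definition D_mult :: "nat \<Rightarrow> ratfun" where "D_mult k = (1 - tt ^ k) * (1 - qq ^ k)"
definition D_star_mult :: "nat \<Rightarrow> ratfun" where
  "D_star_mult k = - ((1 - (1 / tt) ^ k) * (1 - (1 / qq) ^ k))"

section \<open>The operators as finite sums\<close>

lemma Dop_eq:
  "Dop (int a) F = (\<Sum>j\<le>degree (shift_hom D_mult F). coeff (shift_hom D_mult F) j * fps_nth E_series (a + j))"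
proof -
  have "psi k MM = D_mult k" if "k > 0" for k
    using that by (simp add: MM_def D_mult_def psi_simps)
  then show ?thesis
    by (simp add: Dop_def pleth_z_shift fls_nth_poly_inv_mult E_series_def)
qed

lemma Dop_star_eq:
  "Dop_star (int b) F = (\<Sum>j\<le>degree (shift_hom D_star_mult F).
    coeff (shift_hom D_star_mult F) j * fps_nth H_series (b + j))"
proof -
  have "psi k (- MM_tilde) = D_star_mult k" if "k > 0" for k
    using that by (simp add: MM_tilde_def D_star_mult_def psi_simps power_divide)
  moreover have E: "fls_const XX - fls_const (sconst MM_tilde) * fls_X_inv =
      fls_const XX + fls_const (sconst (- MM_tilde)) * fls_X_inv"
    by (simp add: ring_morphism.hom_uminus[OF ring_morphism_sconst])
  ultimately show ?thesis
    unfolding Dop_star_def E by (simp add: pleth_z_shift fls_nth_poly_inv_mult H_series_def)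
qed

lemma pleth_XX:
  assumes "\<And>k. k > 0 \<Longrightarrow> psi k c = m k"
  shows "pleth F (sym_scale c XX) = sym_eval sconst (\<lambda>k. sconst (m k) * psum k) F"
proof (rule ring_morphism_sym_eqI[where F = F and f = "\<lambda>F. pleth F (sym_scale c XX)"])
  show "ring_morphism (\<lambda>F. pleth F (sym_scale c XX))"
    unfolding pleth_def by (intro ring_morphism_sym_eval ring_morphism_sconst)
  show "ring_morphism (sym_eval sconst (\<lambda>k. sconst (m k) * psum k))"
    by (intro ring_morphism_sym_eval ring_morphism_sconst)
  show "pleth (sconst d) (sym_scale c XX) = sym_eval sconst (\<lambda>k. sconst (m k) * psum k) (sconst d)" for d
    by (simp add: pleth_def sym_eval_sconst[OF ring_morphism_sconst])
  show "pleth (psum k) (sym_scale c XX) = sym_eval sconst (\<lambda>k. sconst (m k) * psum k) (psum k)"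
    if "k > 0" for k
    using that by (simp add: pleth_def sym_eval_psum[OF ring_morphism_sconst] sym_scale_def
        ring_morphism.hom_mult[OF ring_morphism_adams] adams_sconst adams_XX assms)
qed

section \<open>The commutator of \<open>D\<^sub>b\<^sup>*\<close> and \<open>D\<^sub>a\<close>\<close>

lemma exp_series_cong:
  "(\<And>k. k > 0 \<Longrightarrow> g k = g' k) \<Longrightarrow> exp_series g f \<longleftrightarrow> exp_series g' f"
  by (simp add: exp_series_def)

text \<open>Omega turns sums of alphabets into products, so the shift multiplies the generating
  series \<open>W\<close> by a scalar series in w y, where y is the shift variable and w the series
  variable. Uniqueness of exponential series makes this precise.\<close>

lemma shift_hom_exp_series:
  assumes W: "exp_series (\<lambda>k. sconst (g k) * psum k) W" and C: "exp_series (\<lambda>k. g k * m k) C"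
  shows "coeff (shift_hom m (fps_nth W n)) l =
    (if l \<le> n then sconst (fps_nth C l) * fps_nth W (n - l) else 0)"
proof -
  interpret s: ring_morphism sconst by (rule ring_morphism_sconst)
  interpret T: ring_morphism "shift_hom m" by (rule ring_morphism_shift_hom)
  let ?y = "monom 1 1 :: sym poly"
  have y: "?y ^ k * [:c:] = monom c k" for k c
    by (simp add: monom_power smult_monom)
  \<comment> \<open>Scaling by \<open>?y\<close> ties the degree in the shift variable to the degree
    in the series variable, so that the l-th coefficient selects one term of the product.\<close>
  define C' where "C' = Abs_fps (\<lambda>n. ?y ^ n * fps_nth (Abs_fps (\<lambda>n. [:sconst (fps_nth C n):])) n)"
  define W' where "W' = Abs_fps (\<lambda>n. [:fps_nth W n:])"
  have "exp_series (\<lambda>k. ?y ^ k * [:sconst (g k * m k):]) C'"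
    unfolding C'_def by (intro exp_series_scale exp_series_hom ring_morphism_sconst_poly C)
  moreover have "exp_series (\<lambda>k. [:sconst (g k) * psum k:]) W'"
    unfolding W'_def by (rule exp_series_hom[OF ring_morphism_pconst W])
  ultimately have 1: "exp_series (\<lambda>k. ?y ^ k * [:sconst (g k * m k):] + [:sconst (g k) * psum k:]) (C' * W')"
    by (rule exp_series_mult)
  have "exp_series (\<lambda>k. shift_hom m (sconst (g k) * psum k)) (Abs_fps (\<lambda>n. shift_hom m (fps_nth W n)))"
    by (rule exp_series_hom[OF ring_morphism_shift_hom W])
  also have "?this \<longleftrightarrow> exp_series (\<lambda>k. ?y ^ k * [:sconst (g k * m k):] + [:sconst (g k) * psum k:])
      (Abs_fps (\<lambda>n. shift_hom m (fps_nth W n)))"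
    unfolding y by (rule exp_series_cong)
      (simp add: T.hom_mult shift_hom_sconst shift_hom_psum s.hom_mult smult_monom add.commute smult_add_right)
  finally have "Abs_fps (\<lambda>n. shift_hom m (fps_nth W n)) = C' * W'"
    using 1 by (rule exp_series_unique)
  then have "shift_hom m (fps_nth W n) = fps_nth (C' * W') n"
    by (metis fps_nth_Abs_fps)
  also have "\<dots> = (\<Sum>i=0..n. monom (sconst (fps_nth C i) * fps_nth W (n - i)) i)"
  proof -
    have "monom c i * [:w:] = monom (c * w) i" for c w :: sym and i
      by (subst mult.commute) (simp add: smult_monom mult.commute)
    then show ?thesis by (simp only: fps_mult_nth C'_def W'_def fps_nth_Abs_fps y)
  qed
  finally show ?thesis
    by (simp add: coeff_sum)
qed

text \<open>The coefficient of z^n in p(1/z) G(z).\<close>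

definition poly_pairing :: "'a::comm_ring_1 poly \<Rightarrow> 'a fps \<Rightarrow> nat \<Rightarrow> 'a" where
  "poly_pairing p G n = (\<Sum>j\<le>degree p. coeff p j * fps_nth G (n + j))"

lemma poly_pairing_bound:
  assumes "degree p \<le> N"
  shows "poly_pairing p G n = (\<Sum>j\<le>N. coeff p j * fps_nth G (n + j))"
  unfolding poly_pairing_def
  by (rule sum.mono_neutral_left) (use assms in \<open>auto simp: coeff_eq_0\<close>)

lemma poly_pairing_add: "poly_pairing (p + q) G n = poly_pairing p G n + poly_pairing q G n"
  by (simp add: poly_pairing_bound[of _ "max (degree p) (degree q)"] degree_add_le_max
      sum.distrib algebra_simps)

lemma poly_pairing_sum: "poly_pairing (\<Sum>i\<in>A. f i) G n = (\<Sum>i\<in>A. poly_pairing (f i) G n)"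
  by (induction A rule: infinite_finite_induct) (simp_all add: poly_pairing_add, simp_all add: poly_pairing_def)

text \<open>A factor z^(-i) raises the index of the extracted coefficient by i.\<close>

lemma poly_pairing_monom_mult:
  "poly_pairing (monom c i * q) G n = c * poly_pairing q G (n + i)"
proof -
  have mon: "poly_pairing (monom c i) G n = c * fps_nth G (n + i)" for c i
    by (subst poly_pairing_bound[of _ i]) (simp_all add: degree_monom_le if_distrib[of "\<lambda>x. x * _"] cong: if_cong)
  have "monom c i * q = (\<Sum>j\<le>degree q. monom (c * coeff q j) (i + j))"
    by (subst poly_as_sum_of_monoms[of q, symmetric]) (simp add: sum_distrib_left mult_monom)
  then show ?thesis
    by (simp add: poly_pairing_sum mon) (simp add: poly_pairing_def sum_distrib_left algebra_simps)
qed

lemma poly_pairing_mult: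
  assumes "degree p \<le> N"
  shows "poly_pairing (p * q) G n = (\<Sum>i\<le>N. coeff p i * poly_pairing q G (n + i))"
proof -
  have "p * q = (\<Sum>i\<le>N. monom (coeff p i) i * q)"
    by (simp add: poly_as_sum_of_monoms'[OF assms] flip: sum_distrib_right)
  then show ?thesis by (simp add: poly_pairing_sum poly_pairing_monom_mult)
qed

text \<open>Both sides are the same coefficient of F with X shifted in two independent variables;
  addition of alphabets is commutative.\<close>

lemma shift_hom_commute:
  "coeff (shift_hom m' (coeff (shift_hom m F) j)) i = coeff (shift_hom m (coeff (shift_hom m' F) i)) j"
proof (induction F arbitrary: i j rule: sym_induct)
  case (sconst c)
  show ?case
    by (simp add: shift_hom_sconst coeff_pCons ring_morphism.hom_zero[OF ring_morphism_shift_hom]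
        split: nat.splits)
next
  case (psum k)
  have c: "coeff (shift_hom m (psum k)) j =
      (if j = 0 then psum k else if j = k then sconst (m k) else 0)" for m j
    using psum by (simp add: shift_hom_psum coeff_pCons split: nat.splits)
  have "coeff (shift_hom m (sconst c)) j = (if j = 0 then sconst c else 0)" for m c j
    by (simp add: shift_hom_sconst coeff_pCons split: nat.splits)
  with psum show ?case
    by (auto simp: c ring_morphism.hom_zero[OF ring_morphism_shift_hom])
next
  case (add F G)
  then show ?case by (simp add: ring_morphism.hom_add[OF ring_morphism_shift_hom])
next
  case (mult F G)
  show ?case
    by (simp add: ring_morphism.hom_mult[OF ring_morphism_shift_hom] coeff_mult
        ring_morphism.hom_sum[OF ring_morphism_shift_hom] coeff_sum mult)
      (rule sum.swap)
qed

text \<open>The cancellation of M/z - M'/w at z = qtw, with the polynomial variable standing for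
  1/w.\<close>

lemma shift_hom_cancel:
  "poly (map_poly (shift_hom D_star_mult) (shift_hom D_mult F)) (monom (sconst (1 / (qq * tt))) 1) = [:F:]"
proof (rule ring_morphism_sym_eqI[where F = F and g = "\<lambda>F. [:F:]"
      and f = "\<lambda>F. poly (map_poly (shift_hom D_star_mult) (shift_hom D_mult F)) (monom (sconst (1 / (qq * tt))) 1)"])
  interpret s: ring_morphism sconst by (rule ring_morphism_sconst)
  let ?x = "monom (sconst (1 / (qq * tt))) 1"
  have e: "ring_morphism (\<lambda>p. poly (map_poly (shift_hom D_star_mult) p) ?x)"
    by (intro ring_morphism_poly_map ring_morphism_shift_hom)
  then show "ring_morphism (\<lambda>F. poly (map_poly (shift_hom D_star_mult) (shift_hom D_mult F)) ?x)"
    by (intro ring_morphism_comp[OF ring_morphism_shift_hom])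
  show "ring_morphism (\<lambda>F. [:F:])" by (rule ring_morphism_pconst)
  show "poly (map_poly (shift_hom D_star_mult) (shift_hom D_mult (sconst c))) ?x = [:sconst c:]" for c
    by (simp add: shift_hom_sconst map_poly_pCons ring_morphism.hom_zero[OF ring_morphism_shift_hom])
  show "poly (map_poly (shift_hom D_star_mult) (shift_hom D_mult (psum k))) ?x = [:psum k:]"
    if k: "k > 0" for k
  proof -
    have "poly (map_poly (shift_hom D_star_mult) (shift_hom D_mult (psum k))) ?x =
        [:psum k:] + monom (sconst (D_star_mult k)) k + [:sconst (D_mult k):] * ?x ^ k"
      using k by (simp add: shift_hom_psum ring_morphism.hom_add[OF e] map_poly_pCons map_poly_monom
          poly_monom shift_hom_sconst ring_morphism.hom_zero[OF ring_morphism_shift_hom]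
          del: One_nat_def)
    also have "[:sconst (D_mult k):] * ?x ^ k = monom (sconst (D_mult k * (1 / (qq * tt)) ^ k)) k"
      by (simp add: monom_power smult_monom s.hom_mult s.hom_power)
    \<comment> \<open>This is M/(qt) = M' after raising q and t to the k-th power.\<close>
    also have "D_mult k * (1 / (qq * tt)) ^ k = - D_star_mult k"
      using qq_nz tt_nz by (simp add: D_mult_def D_star_mult_def field_simps)
    finally show ?thesis
      by (simp add: s.hom_uminus flip: add_monom minus_monom)
  qed
qed

text \<open>The series Omega[wX(1 - qt)], written as Omega[-qtwX] Omega[wX].\<close>

definition K_series :: "sym fps" where
  "K_series = Abs_fps (\<lambda>n. sconst (qq * tt) ^ n * fps_nth E_series n) * H_series"

lemma E_times_H: "E_series * H_series = 1"
  using exp_series_mult[OF exp_series_E exp_series_H] exp_series_one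
  by (intro exp_series_unique[of "\<lambda>k. 0"]) simp_all

lemma exp_series_K: "exp_series (\<lambda>k. sconst (1 - (qq * tt) ^ k) * psum k) K_series"
  using exp_series_mult[OF exp_series_scale[OF exp_series_E, of "sconst (qq * tt)"] exp_series_H]
  by (simp add: K_series_def ring_morphism.hom_simps[OF ring_morphism_sconst] algebra_simps)

text \<open>Since 1 - qt = qt(1/(qt) - 1), homogeneity of h_n pulls out (qt)^n.\<close>

lemma K_series_eq:
  "fps_nth K_series n = sconst ((qq * tt) ^ n) * pleth (hsym n) (sym_scale (1 / (qq * tt) - 1) XX)"
proof -
  interpret s: ring_morphism sconst by (rule ring_morphism_sconst)
  let ?Q = "qq * tt" and ?m = "\<lambda>k. (1 / (qq * tt)) ^ k - 1"
  let ?\<pi> = "sym_eval sconst (\<lambda>k. sconst (?m k) * psum k)"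
  have pleth: "pleth F (sym_scale (1 / ?Q - 1) XX) = ?\<pi> F" for F
    by (rule pleth_XX) (simp add: psi_simps power_divide power_mult_distrib)
  have "exp_series (\<lambda>k. sconst ?Q ^ k * ?\<pi> (psum k))
      (Abs_fps (\<lambda>n. sconst ?Q ^ n * fps_nth (Abs_fps (\<lambda>n. ?\<pi> (fps_nth H_series n))) n))"
    by (intro exp_series_scale exp_series_hom ring_morphism_sym_eval ring_morphism_sconst exp_series_H)
  also have "?this \<longleftrightarrow> exp_series (\<lambda>k. sconst (1 - ?Q ^ k) * psum k)
      (Abs_fps (\<lambda>n. sconst ?Q ^ n * fps_nth (Abs_fps (\<lambda>n. ?\<pi> (fps_nth H_series n))) n))"
  proof (rule exp_series_cong)
    fix k :: nat assume "k > 0"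
    have "?Q ^ k * ?m k = 1 - ?Q ^ k"
      using qq_nz tt_nz by (simp add: field_simps)
    then show "sconst ?Q ^ k * ?\<pi> (psum k) = sconst (1 - ?Q ^ k) * psum k"
      using \<open>k > 0\<close> by (simp add: sym_eval_psum[OF ring_morphism_sconst] mult.assoc[symmetric]
          flip: s.hom_mult s.hom_power)
  qed
  finally have "K_series = Abs_fps (\<lambda>n. sconst ?Q ^ n * fps_nth (Abs_fps (\<lambda>n. ?\<pi> (fps_nth H_series n))) n)"
    using exp_series_K exp_series_unique by blast
  from arg_cong[OF this, of "\<lambda>f. fps_nth f n"] show ?thesis
    by (simp add: pleth s.hom_power hsym_def H_series_def)
qed

text \<open>For l > 0, \<open>pf_coeff (1 / tt) (1 / qq) l\<close> is this constant times 1 -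
  (qt)^(-l), and \<open>pf_coeff tt qq l\<close> is its negative times 1 - (qt)^l.\<close>

abbreviation pf_const :: ratfun where
  "pf_const \<equiv> MM / (qq * tt - 1)"

text \<open>The two expansions of \<open>\<Omega>[z M'/w] = \<Omega>[w M/z]\<close>, with \<open>M' = M/(qt)\<close>, differ by delta functions at
  \<open>z = w\<close> and \<open>z = q t w\<close>; here this is an identity between coefficients.\<close>

lemma expansion_difference:
  assumes "m + k > 0"
  shows "(\<Sum>l\<le>m. sconst (pf_coeff (1 / tt) (1 / qq) l) * fps_nth E_series (m - l) * fps_nth H_series (k + l)) -
      (\<Sum>l\<le>k. sconst (pf_coeff tt qq l) * fps_nth H_series (k - l) * fps_nth E_series (m + l)) =
    - (sconst (pf_const / (qq * tt) ^ m) * fps_nth K_series (m + k))"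
proof -
  interpret s: ring_morphism sconst by (rule ring_morphism_sconst)
  define Q where "Q = qq * tt"
  have Q: "Q \<noteq> 0" "Q \<noteq> 1" using qq_nz tt_nz qt_neq_1 by (simp_all add: Q_def)
  \<comment> \<open>Both sums are indexed by the degree s of the factor from
    \<open>E_series\<close>; the factor from \<open>H_series\<close> then has degree m + k - s. The
    first expansion covers s up to m, the second s from m on.\<close>
  define f where "f s = fps_nth E_series s * fps_nth H_series (m + k - s)" for s
  define c where "c s = (if s \<le> m then pf_coeff (1 / tt) (1 / qq) (m - s) else 0)" for s
  define d where "d s = (if s \<ge> m then pf_coeff tt qq (s - m) else 0)" for s
  \<comment> \<open>The two one-sided sequences glue to a two-sided one: a constant sequence minus a
    geometric one, the delta functions at z = w and z = qtw.\<close>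
  have cd: "c s - d s = pf_const - pf_const / Q ^ m * Q ^ s" for s
  proof -
    consider "s < m" | "s = m" | "s > m" by linarith
    then show ?thesis
    proof cases
      case 1
      then have p: "Q ^ m = Q ^ s * Q ^ (m - s)" by (simp flip: power_add)
      have "pf_coeff (1 / tt) (1 / qq) (m - s) = pf_const * (1 - 1 / Q ^ (m - s))"
      proof -
        have "(1 - 1 / tt) * (1 - 1 / qq) / (1 - 1 / tt * (1 / qq)) = pf_const"
          using qq_nz tt_nz Q by (simp add: Q_def MM_def divide_simps) (simp add: algebra_simps)
        then show ?thesis
          using 1 by (simp add: pf_coeff_def Q_def power_divide mult.commute)
      qed
      then show ?thesis
        using 1 Q by (simp add: c_def d_def p right_diff_distrib)
    next
      case 2
      then show ?thesis using Q by (simp add: c_def d_def pf_coeff_def)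
    next
      case 3
      then have p: "Q ^ s = Q ^ m * Q ^ (s - m)" by (simp flip: power_add)
      have "pf_coeff tt qq (s - m) = - pf_const * (1 - Q ^ (s - m))"
        using 3 Q by (simp add: pf_coeff_def Q_def MM_def divide_simps mult.commute) (simp add: algebra_simps)
      then show ?thesis
        using 3 Q by (simp add: c_def d_def p right_diff_distrib)
    qed
  qed
  have "(\<Sum>l\<le>m. sconst (pf_coeff (1 / tt) (1 / qq) l) * fps_nth E_series (m - l) * fps_nth H_series (k + l)) =
      (\<Sum>s\<le>m. sconst (c s) * f s)"
    by (rule sum.reindex_bij_witness[of _ "\<lambda>s. m - s" "\<lambda>l. m - l"])
      (auto simp: c_def f_def mult.assoc add.commute)
  also have "\<dots> = (\<Sum>s\<le>m+k. sconst (c s) * f s)"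
    by (rule sum.mono_neutral_left) (auto simp: c_def s.hom_zero)
  finally have 1: "(\<Sum>l\<le>m. sconst (pf_coeff (1 / tt) (1 / qq) l) * fps_nth E_series (m - l) *
      fps_nth H_series (k + l)) = (\<Sum>s\<le>m+k. sconst (c s) * f s)" .
  have "(\<Sum>l\<le>k. sconst (pf_coeff tt qq l) * fps_nth H_series (k - l) * fps_nth E_series (m + l)) =
      (\<Sum>s\<in>{m..m+k}. sconst (d s) * f s)"
    by (rule sum.reindex_bij_witness[of _ "\<lambda>s. s - m" "\<lambda>l. m + l"])
      (auto simp: d_def f_def mult.assoc mult.commute)
  also have "\<dots> = (\<Sum>s\<le>m+k. sconst (d s) * f s)"
    by (rule sum.mono_neutral_left) (auto simp: d_def s.hom_zero)
  finally have 2: "(\<Sum>l\<le>k. sconst (pf_coeff tt qq l) * fps_nth H_series (k - l) * fps_nth E_series (m + l)) =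
      (\<Sum>s\<le>m+k. sconst (d s) * f s)" .
  have "(\<Sum>s\<le>m+k. sconst (c s) * f s) - (\<Sum>s\<le>m+k. sconst (d s) * f s) =
      (\<Sum>s\<le>m+k. sconst pf_const * f s - sconst (pf_const / Q ^ m) * (sconst Q ^ s * f s))"
    by (simp only: sum_subtractf[symmetric] left_diff_distrib[symmetric] s.hom_diff[symmetric] cd)
      (simp only: s.hom_diff s.hom_mult s.hom_power left_diff_distrib mult.assoc)
  \<comment> \<open>The constant sequence gives a coefficient of Omega[0] = 1, which vanishes in the
    positive degree m + k; the geometric one gives \<open>K_series\<close>.\<close>
  also have "\<dots> = sconst pf_const * fps_nth (E_series * H_series) (m + k) -
      sconst (pf_const / Q ^ m) * fps_nth K_series (m + k)"
    by (simp add: sum_subtractf sum_distrib_left K_series_def fps_mult_nth f_def atLeast0AtMost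
        Q_def mult.assoc)
  finally show ?thesis
    using assms by (simp only: 1 2 E_times_H) (auto simp: Q_def)
qed

text \<open>Shifting X by -M'/w in Omega[-zX] produces the factor Omega[zM'/w].\<close>

lemma shift_star_E:
  "coeff (shift_hom D_star_mult (fps_nth E_series n)) l =
    (if l \<le> n then sconst (pf_coeff (1 / tt) (1 / qq) l) * fps_nth E_series (n - l) else 0)"
proof -
  interpret s: ring_morphism sconst by (rule ring_morphism_sconst)
  have "1 / tt * (1 / qq) \<noteq> 1"
    using qt_neq_1 qq_nz tt_nz by (simp add: field_simps)
  from exp_series_pf_coeff[OF this] show ?thesis
    using exp_series_E
    by (subst shift_hom_exp_series[where g = "\<lambda>k. -1" and C = "Abs_fps (pf_coeff (1 / tt) (1 / qq))"])
      (simp_all add: s.hom_uminus s.hom_one D_star_mult_def)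
qed

text \<open>Shifting X by M/z in Omega[wX] produces the factor Omega[wM/z].\<close>

lemma shift_H:
  "coeff (shift_hom D_mult (fps_nth H_series n)) l =
    (if l \<le> n then sconst (pf_coeff tt qq l) * fps_nth H_series (n - l) else 0)"
proof -
  interpret s: ring_morphism sconst by (rule ring_morphism_sconst)
  have "tt * qq \<noteq> 1"
    using qt_neq_1 by (simp add: mult.commute)
  from exp_series_pf_coeff[OF this] show ?thesis
    using exp_series_H
    by (subst shift_hom_exp_series[where g = "\<lambda>k. 1" and C = "Abs_fps (pf_coeff tt qq)"])
      (simp_all add: s.hom_one D_mult_def)
qed

lemma poly_pairing_eqI:
  assumes "\<And>l. coeff p l = (if l \<le> n then c l else 0)"
  shows "poly_pairing p G k = (\<Sum>l\<le>n. c l * fps_nth G (k + l))"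
proof -
  have "degree p \<le> n" by (rule degree_le) (simp add: assms)
  then show ?thesis by (simp add: poly_pairing_bound assms)
qed

text \<open>Both products involve the same coefficients of the doubly shifted F, so
  \<open>expansion_difference\<close> applies termwise; the remaining pairing with
  \<open>K_series\<close> collapses by \<open>shift_hom_cancel\<close>.\<close>

lemma Dop_commutator:
  assumes "a + b > 0"
  shows "Dop_star (int b) (Dop (int a) F) - Dop (int a) (Dop_star (int b) F) =
    - (sconst (pf_const / (qq * tt) ^ a) * fps_nth K_series (a + b) * F)"
proof -
  interpret s: ring_morphism sconst by (rule ring_morphism_sconst)
  define T where "T = shift_hom D_mult"
  define Ts where "Ts = shift_hom D_star_mult"
  interpret T: ring_morphism T unfolding T_def by (rule ring_morphism_shift_hom)
  interpret Ts: ring_morphism Ts unfolding Ts_def by (rule ring_morphism_shift_hom)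
  define t where "t F j = coeff (T F) j" for F j
  define ts where "ts F j = coeff (Ts F) j" for F j
  have D: "Dop (int a) F = poly_pairing (T F) E_series a" for F
    by (simp add: Dop_eq poly_pairing_def T_def)
  have Ds: "Dop_star (int b) F = poly_pairing (Ts F) H_series b" for F
    by (simp add: Dop_star_eq poly_pairing_def Ts_def)
  \<comment> \<open>One bound for all degrees lets every sum run over the same rectangle of indices,
    so that sums can be swapped and subtracted.\<close>
  obtain N where N: "degree (T F) \<le> N" "degree (Ts F) \<le> N"
      "\<And>j. degree (Ts (t F j)) \<le> N" "\<And>i. degree (T (ts F i)) \<le> N"
  proof -
    define N where "N = degree (T F) + degree (Ts F) + (\<Sum>j\<le>degree (T F). degree (Ts (t F j)))
      + (\<Sum>i\<le>degree (Ts F). degree (T (ts F i)))"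
    have "degree (Ts (t F j)) \<le> (\<Sum>j\<le>degree (T F). degree (Ts (t F j)))" for j
      by (cases "j \<le> degree (T F)") (auto intro!: member_le_sum simp: t_def coeff_eq_0 Ts.hom_zero)
    moreover have "degree (T (ts F i)) \<le> (\<Sum>i\<le>degree (Ts F). degree (T (ts F i)))" for i
      by (cases "i \<le> degree (Ts F)") (auto intro!: member_le_sum simp: ts_def coeff_eq_0 T.hom_zero)
    ultimately show ?thesis
      by (intro that[of N]) (simp_all add: N_def trans_le_add2 trans_le_add1)
  qed
  have pE: "poly_pairing (Ts (fps_nth E_series n)) G k = (\<Sum>l\<le>n. sconst (pf_coeff (1 / tt) (1 / qq) l) *
      fps_nth E_series (n - l) * fps_nth G (k + l))" for n k G
    by (rule poly_pairing_eqI) (simp add: Ts_def shift_star_E)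
  have pH: "poly_pairing (T (fps_nth H_series n)) G k = (\<Sum>l\<le>n. sconst (pf_coeff tt qq l) *
      fps_nth H_series (n - l) * fps_nth G (k + l))" for n k G
    by (rule poly_pairing_eqI) (simp add: T_def shift_H)
  have "Dop_star (int b) (Dop (int a) F) = poly_pairing (\<Sum>j\<le>N. Ts (t F j) * Ts (fps_nth E_series (a + j))) H_series b"
    by (simp add: Ds D poly_pairing_bound[OF N(1)] Ts.hom_sum Ts.hom_mult t_def)
  also have "\<dots> = (\<Sum>j\<le>N. \<Sum>i\<le>N. ts (t F j) i * (\<Sum>l\<le>a+j. sconst (pf_coeff (1 / tt) (1 / qq) l) *
      fps_nth E_series (a + j - l) * fps_nth H_series (b + i + l)))"
    by (simp add: poly_pairing_sum poly_pairing_mult[OF N(3)] ts_def pE)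
  finally have 1: "Dop_star (int b) (Dop (int a) F) = \<dots>" .
  have "Dop (int a) (Dop_star (int b) F) = poly_pairing (\<Sum>i\<le>N. T (ts F i) * T (fps_nth H_series (b + i))) E_series a"
    by (simp add: Ds D poly_pairing_bound[OF N(2)] T.hom_sum T.hom_mult ts_def)
  also have "\<dots> = (\<Sum>i\<le>N. \<Sum>j\<le>N. t (ts F i) j * (\<Sum>l\<le>b+i. sconst (pf_coeff tt qq l) *
      fps_nth H_series (b + i - l) * fps_nth E_series (a + j + l)))"
    by (simp add: poly_pairing_sum poly_pairing_mult[OF N(4)] t_def pH)
  \<comment> \<open>Commuting shifts bring the second product to the same coefficients as the
    first.\<close>
  also have "\<dots> = (\<Sum>j\<le>N. \<Sum>i\<le>N. ts (t F j) i * (\<Sum>l\<le>b+i. sconst (pf_coeff tt qq l) *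
      fps_nth H_series (b + i - l) * fps_nth E_series (a + j + l)))"
    by (subst sum.swap) (simp add: t_def ts_def T_def Ts_def shift_hom_commute)
  finally have "Dop_star (int b) (Dop (int a) F) - Dop (int a) (Dop_star (int b) F) =
    (\<Sum>j\<le>N. \<Sum>i\<le>N. ts (t F j) i * - (sconst (pf_const / (qq * tt) ^ (a + j)) * fps_nth K_series (a + j + (b + i))))"
    unfolding 1 using assms
    by (simp only: sum_subtractf[symmetric] right_diff_distrib[symmetric])
      (intro sum.cong refl arg_cong2[where f = "(*)"] expansion_difference, auto)
  \<comment> \<open>The factor (qt)^(-j) accompanies z^(-j) from the first shift and amounts to z =
    qtw. The double sum thus becomes a pairing in the single variable 1/w.\<close>
  also have "\<dots> = - (sconst (pf_const / (qq * tt) ^ a) *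
      (\<Sum>j\<le>N. \<Sum>i\<le>N. sconst (1 / (qq * tt)) ^ j * (ts (t F j) i * fps_nth K_series (a + b + j + i))))"
  proof -
    have "sconst (pf_const / (qq * tt) ^ (a + j)) = sconst (pf_const / (qq * tt) ^ a) * sconst (1 / (qq * tt)) ^ j"
      for j by (simp add: power_add power_divide mult.assoc flip: s.hom_mult s.hom_power)
    then show ?thesis
      by (simp only: sum_distrib_left sum_negf[symmetric] mult_minus_right ac_simps)
  qed
  also have "(\<Sum>j\<le>N. \<Sum>i\<le>N. sconst (1 / (qq * tt)) ^ j * (ts (t F j) i * fps_nth K_series (a + b + j + i))) =
      poly_pairing (\<Sum>j\<le>N. monom (sconst (1 / (qq * tt)) ^ j) j * Ts (t F j)) K_series (a + b)"
    by (simp add: poly_pairing_sum poly_pairing_monom_mult poly_pairing_bound[OF N(3)] ts_def sum_distrib_left)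
  also have "(\<Sum>j\<le>N. monom (sconst (1 / (qq * tt)) ^ j) j * Ts (t F j)) =
      poly (map_poly Ts (T F)) (monom (sconst (1 / (qq * tt))) 1)"
  proof -
    have "degree (map_poly Ts (T F)) \<le> N"
      using N(1) by (intro degree_le) (simp add: coeff_map_poly Ts.hom_zero coeff_eq_0)
    then have "poly (map_poly Ts (T F)) x = (\<Sum>j\<le>N. coeff (map_poly Ts (T F)) j * x ^ j)" for x
      unfolding poly_altdef by (intro sum.mono_neutral_left) (auto simp: coeff_eq_0)
    then show ?thesis
      by (simp add: coeff_map_poly Ts.hom_zero t_def monom_power mult.commute)
  qed
  also have "\<dots> = [:F:]" unfolding T_def Ts_def by (rule shift_hom_cancel)
  also have "poly_pairing [:F:] K_series (a + b) = fps_nth K_series (a + b) * F"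
    by (simp add: poly_pairing_def mult.commute)
  finally show ?thesis by (simp only: mult.assoc)
qed

section \<open>Power sum products in finitely many variables\<close>

text \<open>The exponent vector of a power sum product. The index k - 1 would confuse the parts 0
  and 1, whence the conditions below that 0 is not a part.\<close>

definition part_mono :: "nat list \<Rightarrow> (nat \<Rightarrow>\<^sub>0 nat)" where
  "part_mono \<kappa> = (\<Sum>k\<leftarrow>\<kappa>. Poly_Mapping.single (k - 1) 1)"

lemma part_mono_simps [simp]:
  "part_mono [] = 0" "part_mono (k # \<kappa>) = Poly_Mapping.single (k - 1) 1 + part_mono \<kappa>"
  "part_mono (\<kappa> @ \<rho>) = part_mono \<kappa> + part_mono \<rho>"
  by (simp_all add: part_mono_def)

lemma lookup_part_mono:
  "0 \<notin> set \<kappa> \<Longrightarrow> Poly_Mapping.lookup (part_mono \<kappa>) i = count (mset \<kappa>) (Suc i)"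
  by (induction \<kappa>) (auto simp: lookup_add lookup_single when_def)

lemma part_mono_cong: "mset \<kappa> = mset \<rho> \<Longrightarrow> part_mono \<kappa> = part_mono \<rho>"
  unfolding part_mono_def by (metis mset_map sum_mset_sum_list)

lemma part_mono_inj:
  assumes "is_partition \<kappa>" "is_partition \<rho>" "part_mono \<kappa> = part_mono \<rho>"
  shows "\<kappa> = \<rho>"
proof -
  have "0 \<notin> set \<kappa>" "0 \<notin> set \<rho>" using assms(1,2) by (auto simp: is_partition_def)
  then have "count (mset \<kappa>) k = count (mset \<rho>) k" for k
    using assms(3) lookup_part_mono[of \<kappa> "k - 1"] lookup_part_mono[of \<rho> "k - 1"]
    by (cases k) (auto simp: count_eq_zero_iff[THEN iffD2])
  then have "mset (rev \<kappa>) = mset (rev \<rho>)" by (simp add: multiset_eq_iff)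
  moreover have "sorted (rev \<kappa>)" "sorted (rev \<rho>)"
    using assms(1,2) by (simp_all add: is_partition_def sorted_wrt_rev)
  ultimately show ?thesis by (metis properties_for_sort rev_is_rev_conv)
qed

lemma partition_of_list:
  assumes "0 \<notin> set \<kappa>"
  shows "is_partition (rev (sort \<kappa>))"
  using assms by (simp add: is_partition_def sorted_wrt_rev)

text \<open>Together with \<open>part_mono_inj\<close> this indexes the power sum basis by
  partitions.\<close>

lemma part_mono_surj: "\<exists>\<kappa>. is_partition \<kappa> \<and> part_mono \<kappa> = m"
proof -
  have "\<exists>\<kappa>. 0 \<notin> set \<kappa> \<and> part_mono \<kappa> = m"
  proof (induction m rule: poly_mapping_additive_induct)
    case (single i c)
    have "part_mono (replicate c (Suc i)) = Poly_Mapping.single i c"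
      by (induction c) (simp_all flip: single_add)
    then show ?case by (intro exI[of _ "replicate c (Suc i)"]) auto
  next
    case (add m n)
    then show ?case by (metis part_mono_simps(3) set_append Un_iff)
  qed
  then obtain \<kappa> where "0 \<notin> set \<kappa>" "part_mono \<kappa> = m" by blast
  moreover have "part_mono (rev (sort \<kappa>)) = part_mono \<kappa>" by (rule part_mono_cong) simp
  ultimately show ?thesis using partition_of_list by metis
qed

lemma mono_eval_part_mono:
  "0 \<notin> set \<kappa> \<Longrightarrow> mono_eval a (part_mono \<kappa>) = (\<Prod>k\<leftarrow>\<kappa>. a k)"
  by (induction \<kappa>) (auto simp: mono_eval_add, auto simp: mono_eval_def)

text \<open>The coefficient of \<open>x^e\<close> in \<open>p\<^sub>\<kappa>(x\<^sub>0, \<dots>, x\<^sub>N\<^sub>-\<^sub>1)\<close>.\<close>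

fun psum_count :: "nat \<Rightarrow> nat list \<Rightarrow> (nat \<Rightarrow>\<^sub>0 nat) \<Rightarrow> nat" where
  "psum_count N [] e = (if e = 0 then 1 else 0)"
| "psum_count N (k # \<kappa>) e = (\<Sum>i<N. if k \<le> Poly_Mapping.lookup e i
     then psum_count N \<kappa> (e - Poly_Mapping.single i k) else 0)"

lemma single_plus_eq_iff:
  "Poly_Mapping.single i k + b = e \<longleftrightarrow>
    k \<le> Poly_Mapping.lookup e i \<and> b = e - Poly_Mapping.single i (k::nat)"
proof -
  have "Poly_Mapping.single i k + (e - Poly_Mapping.single i k) = e" if "k \<le> Poly_Mapping.lookup e i"
    using that by (intro poly_mapping_eqI) (auto simp: lookup_add lookup_minus lookup_single when_def)
  then show ?thesis by (auto simp: lookup_add)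
qed

lemma lookup_single_times:
  fixes G :: "(nat \<Rightarrow>\<^sub>0 nat) \<Rightarrow>\<^sub>0 'a::comm_ring_1"
  shows "Poly_Mapping.lookup (Poly_Mapping.single (Poly_Mapping.single i k) 1 * G) e =
    (if k \<le> Poly_Mapping.lookup e i then Poly_Mapping.lookup G (e - Poly_Mapping.single i k) else 0)"
  by (induction G rule: poly_mapping_additive_induct)
    (auto simp: mult_single lookup_single when_def single_plus_eq_iff lookup_add algebra_simps)

lemma lookup_psum_product:
  "Poly_Mapping.lookup (\<Prod>k\<leftarrow>\<kappa>. \<Sum>i<N. Poly_Mapping.single (Poly_Mapping.single i k) 1) e =
    (of_nat (psum_count N \<kappa> e) :: 'a::comm_ring_1)"
proof (induction \<kappa> arbitrary: e)
  case (Cons k \<kappa>)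
  show ?case
    by (simp add: sum_distrib_right lookup_sum lookup_single_times Cons if_distrib cong: if_cong)
qed (simp add: lookup_one when_def)

text \<open>The list \<open>js\<close> records from which variable the term of each power sum factor
  is taken.\<close>

definition exponent :: "nat list \<Rightarrow> nat list \<Rightarrow> (nat \<Rightarrow>\<^sub>0 nat)" where
  "exponent js \<kappa> = (\<Sum>(i, k)\<leftarrow>zip js \<kappa>. Poly_Mapping.single i k)"

text \<open>Expanding the product picks one variable for each factor; all terms count positively, so
  nothing cancels.\<close>

lemma psum_count_nonzero_iff:
  "psum_count N \<kappa> e \<noteq> 0 \<longleftrightarrow>
    (\<exists>js. length js = length \<kappa> \<and> set js \<subseteq> {..<N} \<and> exponent js \<kappa> = e)"
proof (induction \<kappa> arbitrary: e)
  case (Cons k \<kappa>)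
  have "psum_count N (k # \<kappa>) e \<noteq> 0 \<longleftrightarrow> (\<exists>i<N. k \<le> Poly_Mapping.lookup e i \<and>
      (\<exists>js. length js = length \<kappa> \<and> set js \<subseteq> {..<N} \<and> exponent js \<kappa> = e - Poly_Mapping.single i k))"
    using Cons by (auto simp: sum_eq_0_iff)
  also have "\<dots> \<longleftrightarrow> (\<exists>i<N. \<exists>js. length js = length \<kappa> \<and> set js \<subseteq> {..<N} \<and>
      exponent (i # js) (k # \<kappa>) = e)"
    by (auto simp: exponent_def single_plus_eq_iff)
  also have "\<dots> \<longleftrightarrow> (\<exists>js. length js = length (k # \<kappa>) \<and> set js \<subseteq> {..<N} \<and> exponent js (k # \<kappa>) = e)"
    (is "?l \<longleftrightarrow> ?r")
  proof
    assume ?l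
    then obtain i js where "i < N" "length js = length \<kappa>" "set js \<subseteq> {..<N}" "exponent (i # js) (k # \<kappa>) = e"
      by blast
    then show ?r by (intro exI[of _ "i # js"]) auto
  next
    assume ?r
    then obtain js where js: "length js = length (k # \<kappa>)" "set js \<subseteq> {..<N}" "exponent js (k # \<kappa>) = e"
      by blast
    then obtain i js' where "js = i # js'" by (cases js) auto
    with js show ?l by (intro exI[of _ i] conjI exI[of _ js']) auto
  qed
  finally show ?case .
qed (auto simp: exponent_def)

definition part_exponent :: "nat list \<Rightarrow> (nat \<Rightarrow>\<^sub>0 nat)" where
  "part_exponent \<nu> = (\<Sum>i<length \<nu>. Poly_Mapping.single i (\<nu> ! i))"

lemma lookup_part_exponent:
  "Poly_Mapping.lookup (part_exponent \<nu>) i = (if i < length \<nu> then \<nu> ! i else 0)"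
  by (simp add: part_exponent_def lookup_sum lookup_single when_def)

lemma sum_lookup_exponent:
  "length js = length \<kappa> \<Longrightarrow> set js \<subseteq> {..<N} \<Longrightarrow>
    (\<Sum>i<N. Poly_Mapping.lookup (exponent js \<kappa>) i) = sum_list \<kappa>"
proof (induction js \<kappa> rule: list_induct2)
  case (Cons j js k \<kappa>)
  then show ?case
    by (simp add: exponent_def lookup_add sum.distrib lookup_single when_def)
qed (simp add: exponent_def)

lemma lookup_exponent_notin: "j \<notin> set js \<Longrightarrow> Poly_Mapping.lookup (exponent js \<kappa>) j = 0"
proof (induction js arbitrary: \<kappa>)
  case (Cons i js)
  then show ?case
    by (cases \<kappa>) (auto simp: exponent_def lookup_add lookup_single when_def)
qed (simp add: exponent_def)

lemma map_lookup_exponent: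
  "length js = length \<kappa> \<Longrightarrow> distinct js \<Longrightarrow> map (Poly_Mapping.lookup (exponent js \<kappa>)) js = \<kappa>"
proof (induction js \<kappa> rule: list_induct2)
  case (Cons j js k \<kappa>)
  have e: "exponent (j # js) (k # \<kappa>) = Poly_Mapping.single j k + exponent js \<kappa>"
    by (simp add: exponent_def)
  have "map (Poly_Mapping.lookup (exponent (j # js) (k # \<kappa>))) js =
      map (Poly_Mapping.lookup (exponent js \<kappa>)) js"
    using Cons.prems by (auto simp: e lookup_add lookup_single when_def)
  moreover have "Poly_Mapping.lookup (exponent (j # js) (k # \<kappa>)) j = k"
    using Cons.prems by (simp add: e lookup_add lookup_exponent_notin)
  ultimately show ?case using Cons by (simp del: map_eq_conv)
qed (simp add: exponent_def)

text \<open>Each variable collects the parts of \<kappa> assigned to it. As \<nu> has no zero part,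
  every variable is used; with equally many parts the assignment is a bijection.\<close>

lemma psum_count_part_exponent:
  assumes "0 \<notin> set \<nu>" "psum_count (length \<nu>) \<kappa> (part_exponent \<nu>) \<noteq> 0"
  shows "sum_list \<kappa> = sum_list \<nu>" "length \<nu> \<le> length \<kappa>"
    "length \<kappa> = length \<nu> \<Longrightarrow> mset \<kappa> = mset \<nu>"
proof -
  let ?N = "length \<nu>"
  from assms(2) obtain js where js: "length js = length \<kappa>" "set js \<subseteq> {..<?N}" "exponent js \<kappa> = part_exponent \<nu>"
    unfolding psum_count_nonzero_iff by blast
  show "sum_list \<kappa> = sum_list \<nu>"
    using sum_lookup_exponent[OF js(1,2)]
    by (simp add: js(3) lookup_part_exponent sum_list_sum_nth atLeast0LessThan)
  have "i \<in> set js" if "i < ?N" for i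
  proof (rule ccontr)
    assume "i \<notin> set js"
    then have "\<nu> ! i = 0" using lookup_exponent_notin[of i js \<kappa>] that by (simp add: js(3) lookup_part_exponent)
    then show False using assms(1) that by (metis nth_mem)
  qed
  then have set_js: "set js = {..<?N}" using js(2) by auto
  then have card_js: "card (set js) = ?N" by simp
  then show "length \<nu> \<le> length \<kappa>" using card_length[of js] js(1) by simp
  assume len: "length \<kappa> = ?N"
  then have dist: "distinct js" using card_js js(1) by (simp add: card_distinct)
  have "\<kappa> = map (Poly_Mapping.lookup (part_exponent \<nu>)) js"
    using map_lookup_exponent[OF js(1) dist] js(3) by simp
  also have "\<dots> = map ((!) \<nu>) js" using set_js by (auto simp: lookup_part_exponent)
  finally have "mset \<kappa> = image_mset ((!) \<nu>) (mset js)" by (metis mset_map)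
  also have "mset js = mset [0..<?N]"
    using dist set_js set_eq_iff_mset_eq_distinct[of js "[0..<?N]"] by (simp add: atLeast0LessThan)
  also have "image_mset ((!) \<nu>) (mset [0..<?N]) = mset \<nu>"
    by (metis map_nth mset_map)
  finally show "mset \<kappa> = mset \<nu>" .
qed

lemma psum_count_diagonal: "psum_count (length \<nu>) \<nu> (part_exponent \<nu>) \<noteq> 0"
  unfolding psum_count_nonzero_iff
proof (intro exI[of _ "[0..<length \<nu>]"] conjI)
  have "zip [0..<length \<nu>] \<nu> = map (\<lambda>i. (i, \<nu> ! i)) [0..<length \<nu>]"
    by (rule nth_equalityI) auto
  then show "exponent [0..<length \<nu>] \<nu> = part_exponent \<nu>"
    by (simp add: exponent_def part_exponent_def interv_sum_list_conv_sum_set_nat atLeast0LessThan comp_def)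
qed auto

section \<open>Monomial coefficients of power sum products\<close>

lemma ring_morphism_in_vars: "ring_morphism (in_vars N)"
  unfolding in_vars_def using ring_morphism_sconst unfolding sconst_def[abs_def]
  by (rule ring_morphism_sym_eval)

lemma mono_coeff_single:
  assumes "0 \<notin> set \<kappa>"
  shows "mono_coeff \<nu> (Poly_Mapping.single (part_mono \<kappa>) c) =
    c * of_nat (psum_count (length \<nu>) \<kappa> (part_exponent \<nu>))"
proof -
  have "in_vars N (Poly_Mapping.single (part_mono \<kappa>) c) = Poly_Mapping.single 0 c *
      (\<Prod>k\<leftarrow>\<kappa>. \<Sum>i<N. Poly_Mapping.single (Poly_Mapping.single i k) 1)" for N
    unfolding in_vars_def using ring_morphism_sconst unfolding sconst_def[abs_def]
    by (simp add: sym_eval_single mono_eval_part_mono[OF assms])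
  moreover have "Poly_Mapping.lookup (Poly_Mapping.single 0 c * G) e = c * Poly_Mapping.lookup G e"
    for e and G :: sym
    by (induction G rule: poly_mapping_additive_induct)
      (auto simp: mult_single lookup_single when_def lookup_add algebra_simps)
  ultimately show ?thesis
    by (simp add: mono_coeff_def lookup_psum_product flip: part_exponent_def)
qed

lemma mono_coeff_add: "mono_coeff \<nu> (F + G) = mono_coeff \<nu> F + mono_coeff \<nu> G"
  by (simp add: mono_coeff_def ring_morphism.hom_add[OF ring_morphism_in_vars] lookup_add)

lemma mono_coeff_sum: "mono_coeff \<nu> (\<Sum>i\<in>A. f i) = (\<Sum>i\<in>A. mono_coeff \<nu> (f i))"
  by (simp add: mono_coeff_def ring_morphism.hom_sum[OF ring_morphism_in_vars] lookup_sum)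

lemma lookup_sym_scale: "Poly_Mapping.lookup (sym_scale c F) m = c * Poly_Mapping.lookup F m"
  by (induction F rule: poly_mapping_additive_induct)
    (auto simp: sym_scale_def sconst_def mult_single lookup_single when_def lookup_add algebra_simps)

lemma sym_scale_single: "sym_scale c (Poly_Mapping.single m d) = Poly_Mapping.single m (c * d)"
  by (simp add: sym_scale_def sconst_def mult_single)

lemma mono_coeff_scale: "mono_coeff \<nu> (sym_scale c F) = c * mono_coeff \<nu> F"
proof (induction F rule: poly_mapping_additive_induct)
  case (single m d)
  obtain \<kappa> where "is_partition \<kappa>" "part_mono \<kappa> = m" using part_mono_surj by blast
  then show ?case
    using mono_coeff_single[of \<kappa> \<nu>] by (auto simp: sym_scale_single is_partition_def algebra_simps)
next
  case (add F G)
  then show ?case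
    by (metis add_mult_distrib2 distrib_left mono_coeff_add sym_scale_def)
qed

section \<open>Triangular families are bases\<close>

definition triangular :: "(nat list \<Rightarrow> sym) \<Rightarrow> bool" where
  "triangular B \<longleftrightarrow> (\<forall>\<mu>. is_partition \<mu> \<longrightarrow> mono_coeff \<mu> (B \<mu>) = 1 \<and>
     (\<forall>\<nu>. is_partition \<nu> \<and> mono_coeff \<nu> (B \<mu>) \<noteq> 0 \<longrightarrow> dominated \<nu> \<mu>))"

text \<open>Transfers homogeneity from the monomial to the power sum expansion. Among power sum
  products of wrong degree in F, a longest one is the only contribution to its own monomial
  coefficient, which is therefore nonzero.\<close>

lemma homogeneousI:
  assumes "\<And>\<nu>. is_partition \<nu> \<Longrightarrow> mono_coeff \<nu> F \<noteq> 0 \<Longrightarrow> sum_list \<nu> = d"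
    and "is_partition \<kappa>" "part_mono \<kappa> \<in> Poly_Mapping.keys F"
  shows "sum_list \<kappa> = d"
proof (rule ccontr)
  assume \<kappa>: "sum_list \<kappa> \<noteq> d"
  define K where "K = {\<rho>. is_partition \<rho> \<and> part_mono \<rho> \<in> Poly_Mapping.keys F \<and> sum_list \<rho> \<noteq> d}"
  have "inj_on part_mono K" by (rule inj_onI) (auto simp: K_def intro: part_mono_inj)
  moreover have "part_mono ` K \<subseteq> Poly_Mapping.keys F" by (auto simp: K_def)
  ultimately have "finite K" by (meson finite_imageD finite_keys finite_subset)
  moreover have "K \<noteq> {}" using assms(2,3) \<kappa> by (auto simp: K_def)
  ultimately have "Max (length ` K) \<in> length ` K"
    and Max: "\<And>\<kappa>. \<kappa> \<in> K \<Longrightarrow> length \<kappa> \<le> Max (length ` K)" by simp_all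
  then obtain \<rho> where \<rho>: "\<rho> \<in> K" and max: "\<And>\<kappa>. \<kappa> \<in> K \<Longrightarrow> length \<kappa> \<le> length \<rho>"
    by auto
  have \<rho>': "is_partition \<rho>" "0 \<notin> set \<rho>" "part_mono \<rho> \<in> Poly_Mapping.keys F" "sum_list \<rho> \<noteq> d"
    using \<rho> by (auto simp: K_def is_partition_def)
  let ?c = "\<lambda>m. mono_coeff \<rho> (Poly_Mapping.single m (Poly_Mapping.lookup F m))"
  have zero: "?c m = 0" if m: "m \<in> Poly_Mapping.keys F" "m \<noteq> part_mono \<rho>" for m
  proof (rule ccontr)
    assume nz: "?c m \<noteq> 0"
    obtain \<kappa> where \<kappa>: "is_partition \<kappa>" "part_mono \<kappa> = m" using part_mono_surj by blast
    then have \<kappa>0: "0 \<notin> set \<kappa>" by (simp add: is_partition_def)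
    have "psum_count (length \<rho>) \<kappa> (part_exponent \<rho>) \<noteq> 0"
    proof
      assume "psum_count (length \<rho>) \<kappa> (part_exponent \<rho>) = 0"
      with nz show False using mono_coeff_single[OF \<kappa>0] \<kappa>(2) by (metis mult_zero_right of_nat_0)
    qed
    note * = psum_count_part_exponent[OF \<rho>'(2) this]
    then have "\<kappa> \<in> K" using \<kappa> m \<rho>' by (simp add: K_def)
    then have "mset \<kappa> = mset \<rho>" using * max by (meson le_antisym)
    then show False using part_mono_cong \<kappa> m by blast
  qed
  have "mono_coeff \<rho> F = (\<Sum>m\<in>Poly_Mapping.keys F. ?c m)"
    by (simp only: mono_coeff_sum[symmetric] poly_mapping_sum_monomials)
  also have "\<dots> = (\<Sum>m\<in>{part_mono \<rho>}. ?c m)"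
    by (rule sum.mono_neutral_right) (use \<rho>' zero in auto)
  also have "\<dots> \<noteq> 0"
    using \<rho>' psum_count_diagonal[of \<rho>] by (simp add: mono_coeff_single in_keys_iff)
  finally show False using assms(1) \<rho>' by blast
qed

text \<open>Partial sums determine the parts; without zero parts they also determine where the list
  ends.\<close>

lemma dominated_antisym:
  assumes "dominated \<mu> \<nu>" "dominated \<nu> \<mu>" "0 \<notin> set \<mu>" "0 \<notin> set \<nu>"
  shows "\<mu> = \<nu>"
proof -
  have "\<forall>k. sum_list (take k \<mu>) = sum_list (take k \<nu>)"
    using assms(1,2) by (auto simp: dominated_def intro: le_antisym)
  then show ?thesis using assms(3,4)
  proof (induction \<mu> arbitrary: \<nu>)
    case Nil
    then show ?case using Nil(1)[rule_format, of 1] by (cases \<nu>) auto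
  next
    case (Cons x \<mu>)
    then obtain y \<nu>' where \<nu>: "\<nu> = y # \<nu>'"
      using Cons.prems(1)[rule_format, of 1] by (cases \<nu>) auto
    have "x = y" using Cons.prems(1)[rule_format, of 1] \<nu> by simp
    moreover have "sum_list (take k \<mu>) = sum_list (take k \<nu>')" for k
      using Cons.prems(1)[rule_format, of "Suc k"] \<nu> \<open>x = y\<close> by simp
    ultimately show ?case using Cons \<nu> by simp
  qed
qed

text \<open>For a dominance-maximal index \<rho> with nonzero coefficient, no other term of the
  relation contains the monomial function of \<rho>.\<close>

lemma triangular_coefficients_zero:
  assumes B: "triangular B" and S: "finite S" "\<And>\<mu>. \<mu> \<in> S \<Longrightarrow> is_partition \<mu>"
    and sum: "(\<Sum>\<mu>\<in>S. sym_scale (c \<mu>) (B \<mu>)) = 0" and "\<mu> \<in> S"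
  shows "c \<mu> = 0"
proof (rule ccontr)
  assume "c \<mu> \<noteq> 0"
  define S' where "S' = {\<mu> \<in> S. c \<mu> \<noteq> 0}"
  have 0: "0 \<notin> set \<mu>" if "\<mu> \<in> S'" for \<mu> using S(2) that by (auto simp: S'_def is_partition_def)
  define R where "R x y \<longleftrightarrow> dominated x y \<and> x \<noteq> y" for x y
  have "finite S'" "S' \<noteq> {}" using S \<open>c \<mu> \<noteq> 0\<close> \<open>\<mu> \<in> S\<close> by (auto simp: S'_def)
  moreover have "asymp_on S' R"
    by (rule asymp_onI) (auto simp: R_def dest: dominated_antisym 0)
  moreover have "transp_on S' R"
  proof (rule transp_onI)
    fix x y z assume xyz: "x \<in> S'" "y \<in> S'" "z \<in> S'" "R x y" "R y z"
    then have "dominated x z" by (auto simp: R_def dominated_def intro: order_trans)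
    moreover have "x \<noteq> z" using xyz dominated_antisym 0 by (auto simp: R_def)
    ultimately show "R x z" by (simp add: R_def)
  qed
  ultimately obtain \<rho> where \<rho>: "\<rho> \<in> S'" "\<And>x. x \<in> S' \<Longrightarrow> x \<noteq> \<rho> \<Longrightarrow> \<not> R \<rho> x"
    using Finite_Set.bex_max_element[of S' R] by blast
  have \<rho>S: "\<rho> \<in> S" "is_partition \<rho>" using \<rho> S by (auto simp: S'_def)
  have "0 = (\<Sum>\<mu>\<in>S. c \<mu> * mono_coeff \<rho> (B \<mu>))"
    using arg_cong[OF sum, of "mono_coeff \<rho>"]
    by (simp add: mono_coeff_sum mono_coeff_scale) (simp add: mono_coeff_def ring_morphism.hom_zero[OF ring_morphism_in_vars])
  also have "\<dots> = (\<Sum>\<mu>\<in>{\<rho>}. c \<mu> * mono_coeff \<rho> (B \<mu>))"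
  proof (rule sum.mono_neutral_right)
    show "\<forall>\<mu>\<in>S - {\<rho>}. c \<mu> * mono_coeff \<rho> (B \<mu>) = 0"
    proof (intro ballI, rule ccontr)
      fix \<mu> assume "\<mu> \<in> S - {\<rho>}" "c \<mu> * mono_coeff \<rho> (B \<mu>) \<noteq> 0"
      then show False using \<rho>(2)[of \<mu>] B S \<rho>S by (auto simp: S'_def R_def triangular_def)
    qed
  qed (use S \<rho>S in auto)
  also have "\<dots> = c \<rho>" using B \<rho>S by (simp add: triangular_def)
  finally show False using \<rho> by (simp add: S'_def)
qed

section \<open>Independence and spanning over the field of rational functions\<close>

interpretation sym: vector_space sym_scale
  by unfold_locales
    (simp_all add: sym_scale_def ring_morphism.hom_simps[OF ring_morphism_sconst] algebra_simps)

interpretation sym_pair: vector_space_pair sym_scale sym_scale ..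

lemma triangular_inj_on:
  assumes "triangular B"
  shows "inj_on B {\<mu>. is_partition \<mu>}"
proof (rule inj_onI, rule ccontr)
  fix \<mu> \<nu> assume *: "\<mu> \<in> {\<mu>. is_partition \<mu>}" "\<nu> \<in> {\<mu>. is_partition \<mu>}" "B \<mu> = B \<nu>" "\<mu> \<noteq> \<nu>"
  have "(if \<mu> = \<mu> then 1 else -1 :: ratfun) = 0"
    by (rule triangular_coefficients_zero[OF assms, of "{\<mu>, \<nu>}" "\<lambda>x. if x = \<mu> then 1 else -1"])
      (use * in auto)
  then show False by simp
qed

lemma triangular_independent:
  assumes "triangular B"
  shows "sym.independent (B ` {\<mu>. is_partition \<mu>})"
  unfolding sym.independent_explicit_finite_subsets
proof (intro allI impI ballI)
  fix S u v assume S: "S \<subseteq> B ` {\<mu>. is_partition \<mu>}" "finite S" "(\<Sum>v\<in>S. sym_scale (u v) v) = 0" "v \<in> S"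
  then obtain S' where S': "S' \<subseteq> {\<mu>. is_partition \<mu>}" "finite S'" "S = B ` S'"
    by (meson finite_subset_image)
  then have inj: "inj_on B S'" using triangular_inj_on[OF assms] inj_on_subset by blast
  obtain \<mu> where \<mu>: "\<mu> \<in> S'" "v = B \<mu>" using S(4) S'(3) by blast
  have "u (B \<mu>) = 0"
    by (rule triangular_coefficients_zero[OF assms S'(2), where c = "\<lambda>\<mu>. u (B \<mu>)"])
      (use S S' \<mu> sum.reindex[OF inj, of "\<lambda>v. sym_scale (u v) v"] in auto)
  then show "u v = 0" using \<mu> by simp
qed

lemma finite_partitions: "finite {\<mu>. is_partition \<mu> \<and> sum_list \<mu> = d}"
proof (rule finite_subset)
  have "length \<mu> \<le> sum_list \<mu>" if "0 \<notin> set \<mu>" for \<mu> :: "nat list"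
    using that by (induction \<mu>) auto
  then show "{\<mu>. is_partition \<mu> \<and> sum_list \<mu> = d} \<subseteq> {\<mu>. set \<mu> \<subseteq> {..d} \<and> length \<mu> \<le> d}"
    by (auto simp: is_partition_def member_le_sum_list)
  show "finite {\<mu>. set \<mu> \<subseteq> {..d} \<and> length \<mu> \<le> d}"
    by (rule finite_lists_length_le) simp
qed

text \<open>In each degree the family and the power sum products are both indexed by the same finite
  set of partitions, so independence forces spanning.\<close>

lemma triangular_span:
  assumes "triangular B"
  shows "sym.span (B ` {\<mu>. is_partition \<mu>}) = UNIV"
proof -
  let ?p = "\<lambda>m. Poly_Mapping.single m (1::ratfun)"
  have expand: "F = (\<Sum>m\<in>Poly_Mapping.keys F. sym_scale (Poly_Mapping.lookup F m) (?p m))" for F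
    by (simp add: sym_scale_single poly_mapping_sum_monomials)
  have "?p m \<in> sym.span (B ` {\<mu>. is_partition \<mu>})" for m
  proof -
    obtain \<rho> where \<rho>: "is_partition \<rho>" "part_mono \<rho> = m" using part_mono_surj by blast
    define D where "D = {\<mu>. is_partition \<mu> \<and> sum_list \<mu> = sum_list \<rho>}"
    define T where "T = (\<lambda>\<kappa>. ?p (part_mono \<kappa>)) ` D"
    have fin: "finite D" "finite T" unfolding T_def D_def by (simp_all add: finite_partitions)
    have sub: "B ` D \<subseteq> sym.span T"
    proof safe
      fix \<mu> assume \<mu>: "\<mu> \<in> D"
      have "?p k \<in> sym.span T" if k: "k \<in> Poly_Mapping.keys (B \<mu>)" for k
      proof -
        obtain \<kappa> where \<kappa>: "is_partition \<kappa>" "part_mono \<kappa> = k" using part_mono_surj by blast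
        have "sum_list \<kappa> = sum_list \<rho>"
        proof (rule homogeneousI)
          show "is_partition \<kappa>" "part_mono \<kappa> \<in> Poly_Mapping.keys (B \<mu>)" using \<kappa> k by simp_all
          fix \<nu> assume "is_partition \<nu>" "mono_coeff \<nu> (B \<mu>) \<noteq> 0"
          then have "dominated \<nu> \<mu>" using assms \<mu> unfolding triangular_def D_def by blast
          then show "sum_list \<nu> = sum_list \<rho>" using \<mu> by (simp add: dominated_def D_def)
        qed
        with \<kappa> show ?thesis unfolding T_def D_def by (intro sym.span_base) auto
      qed
      then show "B \<mu> \<in> sym.span T"
        by (subst expand[of "B \<mu>"]) (intro sym.span_sum sym.span_scale)
    qed
    have D: "D \<subseteq> {\<mu>. is_partition \<mu>}" by (auto simp: D_def)
    have ind: "sym.independent (B ` D)"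
      using triangular_independent[OF assms] D by (meson image_mono sym.independent_mono)
    have "card (B ` D) = card D"
      using triangular_inj_on[OF assms] D by (meson card_image inj_on_subset)
    \<comment> \<open>Otherwise adjoining \<open>?p m\<close> would give \<open>card D + 1\<close>
      independent vectors in the span of at most \<open>card D\<close> vectors.\<close>
    have "?p m \<in> sym.span (B ` D)"
    proof (rule ccontr)
      assume np: "?p m \<notin> sym.span (B ` D)"
      then have "sym.independent (insert (?p m) (B ` D))" using ind by (rule sym.independent_insertI)
      moreover have "?p m \<in> T" using \<rho> by (auto simp: T_def D_def)
      then have "insert (?p m) (B ` D) \<subseteq> sym.span T" using sub by (simp add: sym.span_base)
      ultimately have "card (insert (?p m) (B ` D)) \<le> card T"
        using sym.independent_span_bound[OF fin(2)] by blast
      moreover have "?p m \<notin> B ` D" using np sym.span_base by blast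
      moreover have "card T \<le> card D" unfolding T_def by (rule card_image_le[OF fin(1)])
      ultimately show False using \<open>card (B ` D) = card D\<close> fin by simp
    qed
    then show ?thesis using sym.span_mono[OF image_mono[OF D, of B]] by blast
  qed
  then have "F \<in> sym.span (B ` {\<mu>. is_partition \<mu>})" for F
    by (subst expand[of F]) (intro sym.span_sum sym.span_scale)
  then show ?thesis by blast
qed

section \<open>The operator \<open>\<nabla>\<close>\<close>

text \<open>Ensures that the definite description in \<open>nabla\<close> denotes an operator:
  prescribed eigenvalues on a basis extend linearly in exactly one way.\<close>

lemma diagonal_operator:
  assumes inj: "inj_on G A" and ind: "sym.independent (G ` A)" and span: "sym.span (G ` A) = UNIV"
    and nz: "\<And>\<mu>. \<mu> \<in> A \<Longrightarrow> e \<mu> \<noteq> 0"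
  defines "Q \<equiv> \<lambda>N. Vector_Spaces.linear sym_scale sym_scale N \<and> (\<forall>\<mu>\<in>A. N (G \<mu>) = sym_scale (e \<mu>) (G \<mu>))"
  shows "\<exists>!N. Q N" and "Q N \<Longrightarrow> bij N"
proof -
  have ex: "\<exists>N. Vector_Spaces.linear sym_scale sym_scale N \<and> (\<forall>\<mu>\<in>A. N (G \<mu>) = sym_scale (f \<mu>) (G \<mu>))" for f
  proof -
    obtain N where "Vector_Spaces.linear sym_scale sym_scale N"
      "\<forall>x\<in>G ` A. N x = sym_scale (f (inv_into A G x)) x"
      using sym_pair.linear_independent_extend[OF ind, of "\<lambda>x. sym_scale (f (inv_into A G x)) x"] by blast
    then show ?thesis using inj by auto
  qed
  have eq: "N = N'" if "Vector_Spaces.linear sym_scale sym_scale N" "Vector_Spaces.linear sym_scale sym_scale N'"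
    "\<And>\<mu>. \<mu> \<in> A \<Longrightarrow> N (G \<mu>) = N' (G \<mu>)" for N N'
  proof
    fix F
    show "N F = N' F"
      by (rule sym_pair.linear_eq_on[OF that(1,2), of _ "G ` A"]) (use that(3) span in auto)
  qed
  show "\<exists>!N. Q N"
    using ex[of e] eq unfolding Q_def by (metis (no_types, lifting))
  assume N: "Q N"
  \<comment> \<open>The inverse is the diagonal operator with reciprocal eigenvalues.\<close>
  obtain N' where N': "Vector_Spaces.linear sym_scale sym_scale N'"
    "\<forall>\<mu>\<in>A. N' (G \<mu>) = sym_scale (1 / e \<mu>) (G \<mu>)" using ex[of "\<lambda>\<mu>. 1 / e \<mu>"] by blast
  have id: "Vector_Spaces.linear sym_scale sym_scale (\<lambda>x. x)"
    by (simp add: Vector_Spaces.linear_iff sym.vector_space_axioms)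
  have "(\<lambda>F. N (N' F)) = (\<lambda>x. x)" "(\<lambda>F. N' (N F)) = (\<lambda>x. x)"
    by (rule eq; use N N' nz id in \<open>simp add: Q_def Vector_Spaces.linear_iff\<close>)+
  then show "bij N" by (metis bij_iff)
qed

section \<open>Change of coefficients and rescaling of the alphabet\<close>

lemma poly_mapping_map_add:
  assumes "ring_morphism h"
  shows "Poly_Mapping.map h (F + G) = Poly_Mapping.map h F + Poly_Mapping.map h G"
  by (rule poly_mapping_eqI)
    (auto simp: lookup_add map.rep_eq when_def ring_morphism.hom_zero[OF assms]
      simp flip: ring_morphism.hom_add[OF assms])

text \<open>Power sum products have integer monomial coefficients, which a ring homomorphism
  fixes.\<close>

lemma mono_coeff_map:
  assumes h: "ring_morphism h"
  shows "mono_coeff \<nu> (Poly_Mapping.map h F) = h (mono_coeff \<nu> F)"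
proof (induction F rule: poly_mapping_additive_induct)
  case (single m d)
  obtain \<kappa> where "is_partition \<kappa>" "part_mono \<kappa> = m" using part_mono_surj by blast
  then show ?case
    using mono_coeff_single[of \<kappa> \<nu>]
    by (auto simp: is_partition_def ring_morphism.hom_simps[OF h])
qed (simp add: poly_mapping_map_add[OF h] mono_coeff_add ring_morphism.hom_add[OF h])

lemma map_sym_scale:
  assumes h: "ring_morphism h"
  shows "Poly_Mapping.map h (sym_scale c F) = sym_scale (h c) (Poly_Mapping.map h F)"
  by (rule poly_mapping_eqI)
    (auto simp: lookup_sym_scale map.rep_eq when_def ring_morphism.hom_simps[OF h])

lemma triangular_map:
  assumes "ring_morphism h" "triangular B"
  shows "triangular (\<lambda>\<mu>. Poly_Mapping.map h (B \<mu>))"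
  using assms(2) ring_morphism.hom_zero[OF assms(1)] ring_morphism.hom_one[OF assms(1)]
  unfolding triangular_def mono_coeff_map[OF assms(1)] by metis

text \<open>Rescaling the alphabet acts diagonally on power sum products, so it is invertible as
  soon as all factors are nonzero.\<close>

lemma lookup_pleth_XX:
  assumes "\<And>k. k > 0 \<Longrightarrow> psi k c = m k"
  shows "Poly_Mapping.lookup (pleth F (sym_scale c XX)) n = Poly_Mapping.lookup F n * mono_eval m n"
proof -
  have e: "mono_eval (\<lambda>k. sconst (m k) * psum k) n = Poly_Mapping.single n (mono_eval m n)" for n
  proof (induction n rule: poly_mapping_additive_induct)
    case (single i k)
    have "psum (Suc i) ^ k = Poly_Mapping.single (Poly_Mapping.single i k) 1"
      by (induction k) (simp_all add: psum_def mult_single flip: single_add)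
    then show ?case
      by (simp add: mono_eval_def power_mult_distrib flip: ring_morphism.hom_power[OF ring_morphism_sconst])
        (simp add: sconst_def mult_single)
  qed (simp add: mono_eval_add mult_single)
  have p: "pleth F (sym_scale c XX) = sym_eval sconst (\<lambda>k. sconst (m k) * psum k) F" for F
    by (rule pleth_XX) (rule assms)
  show ?thesis
    unfolding p
  proof (induction F rule: poly_mapping_additive_induct)
    case (single k d)
    show ?case
      by (simp add: sym_eval_single[OF ring_morphism_sconst] e)
        (simp add: sconst_def mult_single lookup_single when_def)
  qed (simp add: sym_eval_add[OF ring_morphism_sconst] lookup_add algebra_simps)
qed

lemma c_norm_nonzero: "c_norm \<mu> \<noteq> 0"
proof -
  have "1 - qq ^ i * tt ^ (j + 1) \<noteq> 0" for i j
    using qq_tt_power_eq_1_iff[of i "j + 1"] by simp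
  then show ?thesis
    by (simp only: c_norm_def prod_zero_iff finite_lessThan) blast
qed

lemma nabla_linear_bij:
  assumes "is_Macdonald_P P"
  shows "Vector_Spaces.linear sym_scale sym_scale (nabla P)" "bij (nabla P)"
proof -
  define \<sigma> where "\<sigma> = ratfun_subst qq (1 / tt)"
  have \<sigma>: "ring_morphism \<sigma>" unfolding \<sigma>_def by (intro ring_morphism_ratfun_subst alg_indep_inverse)
  define B where "B \<mu> = Poly_Mapping.map \<sigma> (P \<mu>)" for \<mu>
  define \<Theta> where "\<Theta> F = pleth F (sym_scale (1 / (1 - 1 / tt)) XX)" for F
  define s where "s \<mu> = tt ^ n_stat \<mu> * \<sigma> (c_norm \<mu>)" for \<mu>
  define e where "e \<mu> = tt ^ n_stat \<mu> * qq ^ n_stat (conj_part \<mu>)" for \<mu>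
  let ?A = "{\<mu>. is_partition \<mu>}"
  define r where "r n = mono_eval (\<lambda>k. 1 / (1 - 1 / tt ^ k)) n" for n
  have \<Theta>: "Poly_Mapping.lookup (\<Theta> F) n = Poly_Mapping.lookup F n * r n" for F n
    unfolding \<Theta>_def r_def by (rule lookup_pleth_XX) (simp add: psi_simps)
  have "tt ^ Suc k \<noteq> 1" for k using qq_tt_power_eq_1_iff[of 0 "Suc k"] by simp
  then have "1 - 1 / tt ^ Suc k \<noteq> 0" for k using tt_nz by (simp add: field_simps)
  then have r: "r n \<noteq> 0" for n
    unfolding r_def by (intro mono_eval_nonzero) (metis divide_eq_0_iff one_neq_zero)
  have \<Theta>_linear: "Vector_Spaces.linear sym_scale sym_scale \<Theta>"
    unfolding Vector_Spaces.linear_iff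
    by (auto intro!: poly_mapping_eqI sym.vector_space_axioms simp: \<Theta> lookup_add lookup_sym_scale algebra_simps)
  have \<Theta>_inj: "inj \<Theta>"
  proof (rule injI, rule poly_mapping_eqI)
    fix F G n assume "\<Theta> F = \<Theta> G"
    then show "Poly_Mapping.lookup F n = Poly_Mapping.lookup G n"
      using \<Theta>[of F n] \<Theta>[of G n] r[of n] by simp
  qed
  have \<Theta>_surj: "surj \<Theta>"
  proof (rule surjI)
    fix F
    define G where "G = (\<Sum>n\<in>Poly_Mapping.keys F. Poly_Mapping.single n (Poly_Mapping.lookup F n / r n))"
    have "Poly_Mapping.lookup G n = Poly_Mapping.lookup F n / r n" for n
      by (simp add: G_def lookup_sum lookup_single when_def in_keys_iff)
    then show "\<Theta> (\<Sum>n\<in>Poly_Mapping.keys F. Poly_Mapping.single n (Poly_Mapping.lookup F n / r n)) = F"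
      unfolding G_def[symmetric] using r by (intro poly_mapping_eqI) (simp add: \<Theta>)
  qed
  have tri: "triangular B"
    unfolding B_def by (intro triangular_map \<sigma>) (use assms in \<open>simp add: is_Macdonald_P_def triangular_def\<close>)
  define G where "G \<mu> = \<Theta> (B \<mu>)" for \<mu>
  have GB: "G ` ?A = \<Theta> ` (B ` ?A)" by (auto simp: G_def)
  have G_inj: "inj_on G ?A"
    using triangular_inj_on[OF tri] \<Theta>_inj by (auto simp: inj_on_def G_def)
  have G_ind: "sym.independent (G ` ?A)"
    unfolding GB
    by (intro sym_pair.linear_independent_injective_image[OF \<Theta>_linear] triangular_independent[OF tri]
        inj_on_subset[OF \<Theta>_inj]) simp
  have G_span: "sym.span (G ` ?A) = UNIV"
    unfolding GB sym_pair.linear_span_image[OF \<Theta>_linear] triangular_span[OF tri] by (rule \<Theta>_surj)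
  have s: "s \<mu> \<noteq> 0" for \<mu>
    using c_norm_nonzero tt_nz by (simp add: s_def ring_morphism_eq_0_iff[OF \<sigma>])
  have H: "Macdonald_H P \<mu> = sym_scale (s \<mu>) (G \<mu>)" for \<mu>
    using \<Theta>_linear
    by (simp add: Macdonald_H_def Macdonald_J_def map_sym_scale[OF \<sigma>] s_def G_def B_def Vector_Spaces.linear_iff
        flip: \<sigma>_def \<Theta>_def)
  \<comment> \<open>Nonzero multiples share the eigenvector condition, so \<open>nabla\<close> can
    be described through the basis \<open>G\<close>.\<close>
  have "N (Macdonald_H P \<mu>) = sym_scale (e \<mu>) (Macdonald_H P \<mu>) \<longleftrightarrow> N (G \<mu>) = sym_scale (e \<mu>) (G \<mu>)"
    if "Vector_Spaces.linear sym_scale sym_scale N" for N \<mu>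
  proof -
    have "N (Macdonald_H P \<mu>) = sym_scale (s \<mu>) (N (G \<mu>))"
      using that by (simp add: H Vector_Spaces.linear_iff)
    moreover have "sym_scale (e \<mu>) (Macdonald_H P \<mu>) = sym_scale (s \<mu>) (sym_scale (e \<mu>) (G \<mu>))"
      by (simp add: H mult.commute)
    ultimately show ?thesis using s[of \<mu>] by (simp del: sym.scale_scale)
  qed
  then have nabla: "nabla P = (THE N. Vector_Spaces.linear sym_scale sym_scale N \<and>
      (\<forall>\<mu>\<in>?A. N (G \<mu>) = sym_scale (e \<mu>) (G \<mu>)))"
    unfolding nabla_def e_def[symmetric] by (intro arg_cong[where f = The] ext) auto
  have e: "e \<mu> \<noteq> 0" for \<mu> using qq_nz tt_nz by (simp add: e_def)
  note diag = diagonal_operator[OF G_inj G_ind G_span, of e, OF e]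
  have "Vector_Spaces.linear sym_scale sym_scale (nabla P) \<and>
      (\<forall>\<mu>\<in>?A. nabla P (G \<mu>) = sym_scale (e \<mu>) (G \<mu>))"
    unfolding nabla by (rule theI'[OF diag(1)])
  then show "Vector_Spaces.linear sym_scale sym_scale (nabla P)" "bij (nabla P)"
    using diag(2) by blast+
qed

section \<open>Conjugation by \<open>\<nabla>\<close>\<close>

text \<open>Lets the scalar in \<open>Psi\<close> pass through the operator in
  \<open>Phi\<close>.\<close>

lemma Dop_scale: "Dop (int a) (sym_scale c F) = sym_scale c (Dop (int a) F)"
proof -
  have "shift_hom D_mult (sym_scale c F) = monom (sconst c) 0 * shift_hom D_mult F"
    by (simp add: sym_scale_def ring_morphism.hom_mult[OF ring_morphism_shift_hom] shift_hom_sconst monom_0)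
  then show ?thesis
    using poly_pairing_monom_mult[of "sconst c" 0 "shift_hom D_mult F" E_series a]
    by (simp add: Dop_eq sym_scale_def flip: poly_pairing_def)
qed

lemma MM_nonzero: "MM \<noteq> 0"
  using qq_tt_power_eq_1_iff[of 1 0] qq_tt_power_eq_1_iff[of 0 1] by (auto simp: MM_def)

theorem theorem1p3:
  fixes P :: "nat list \<Rightarrow> sym" and a b n :: nat
  assumes "is_Macdonald_P P"
    and "a > 0" and "b > 0" and "a + b = n"
  shows "sym_scale (1 / MM) \<circ> commutator (Psi P b) (Phi P a) =
    sym_scale (qq * tt / (qq * tt - 1)) \<circ>
      (nabla P \<circ> (\<lambda>F. pleth (hsym n) (sym_scale (1 / (qq * tt) - 1) XX) * F) \<circ> inv (nabla P))"
proof
  fix F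
  let ?N = "nabla P" and ?Q = "qq * tt"
  let ?h = "pleth (hsym n) (sym_scale (1 / ?Q - 1) XX)"
  let ?c = "- (?Q powi (1 - int b))"
  \<comment> \<open>Inside each product \<open>inv ?N\<close> meets \<open>?N\<close> and cancels,
    leaving one outer conjugation and operators applied to \<open>G\<close>.\<close>
  define G where "G = inv ?N F"
  have lin: "Vector_Spaces.linear sym_scale sym_scale ?N" and "bij ?N"
    using nabla_linear_bij[OF assms(1)] by blast+
  then have invN: "inv ?N (?N x) = x" for x by (simp add: bij_is_inj)
  have N_scale: "?N (sym_scale c x) = sym_scale c (?N x)" for c x
    using lin by (simp add: Vector_Spaces.linear_iff)
  have N_diff: "?N x - ?N y = ?N (x - y)" for x y
    using lin N_scale[of "-1" y] unfolding Vector_Spaces.linear_iff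
    by (metis diff_add_cancel add_diff_cancel_right')
  have Q: "?Q \<noteq> 0" "?Q \<noteq> 1" using qq_nz tt_nz qt_neq_1 by simp_all
  have "commutator (Psi P b) (Phi P a) F = sym_scale ?c
      (?N (Dop_star (int b) (Dop (int a) G) - Dop (int a) (Dop_star (int b) G)))"
  proof -
    have "Psi P b (Phi P a F) = sym_scale ?c (?N (Dop_star (int b) (Dop (int a) G)))"
      by (simp only: Psi_def Phi_def o_apply invN G_def)
    moreover have "Phi P a (Psi P b F) = sym_scale ?c (?N (Dop (int a) (Dop_star (int b) G)))"
      by (simp only: Psi_def Phi_def o_apply N_scale[symmetric] invN G_def Dop_scale)
    ultimately show ?thesis
      by (simp only: commutator_def N_diff[symmetric] sym.scale_right_diff_distrib)
  qed
  also have "Dop_star (int b) (Dop (int a) G) - Dop (int a) (Dop_star (int b) G) =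
      sym_scale (- (pf_const / ?Q ^ a * ?Q ^ n)) (?h * G)"
  proof -
    interpret s: ring_morphism sconst by (rule ring_morphism_sconst)
    have "a + b > 0" using assms(2) by simp
    from Dop_commutator[OF this, of G] show ?thesis
      unfolding assms(4) K_series_eq
      by (simp only: sym_scale_def s.hom_mult s.hom_uminus mult.assoc mult_minus_left)
  qed
  finally have comm: "commutator (Psi P b) (Phi P a) F =
      sym_scale (?c * - (pf_const / ?Q ^ a * ?Q ^ n)) (?N (?h * G))"
    by (simp only: N_scale sym.scale_scale)
  \<comment> \<open>The exponents of qt are 1 - b from \<open>Psi\<close>, -a from
    \<open>Dop_commutator\<close> and n = a + b from \<open>K_series_eq\<close>, so one factor qt
    remains; the two minus signs cancel.\<close>
  have "?Q powi (1 - int b) * ?Q ^ b = ?Q"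
    using Q by (simp add: power_int_diff)
  moreover have "?Q ^ n = ?Q ^ a * ?Q ^ b" using assms(4) by (simp flip: power_add)
  ultimately have "1 / MM * (?c * - (pf_const / ?Q ^ a * ?Q ^ n)) = ?Q / (?Q - 1)"
  proof -
    assume p: "?Q powi (1 - int b) * ?Q ^ b = ?Q" and n: "?Q ^ n = ?Q ^ a * ?Q ^ b"
    have "1 / MM * (?c * - (pf_const / ?Q ^ a * ?Q ^ n)) = (?Q powi (1 - int b) * ?Q ^ b) / (?Q - 1)"
      using Q MM_nonzero by (simp add: n)
    then show ?thesis by (simp only: p)
  qed
  then show "(sym_scale (1 / MM) \<circ> commutator (Psi P b) (Phi P a)) F =
      (sym_scale (?Q / (?Q - 1)) \<circ> (?N \<circ> (\<lambda>F. ?h * F) \<circ> inv ?N)) F"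
    by (simp only: o_apply comm sym.scale_scale G_def)
qed

end
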